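(* For all integers $a\ge 1$, the defining ideal $\mathrm{gr}\,\mathbf{I}(\Pi_{(a^2)})\subseteq\mathbb{C}\big[\mathbf{x}_{\binom{[2a]}{2}}\big]$ of $R(\Pi_{(a^2)})$ is generated by - all products $x_S\cdot x_T$ for $S,T\in\binom{[2a]}{2}$ with $S\cap T\neq\varnothing$ ($S$ may equal $T$), - all sums $\sum_{j\in[2a],\, j\neq i} x_{\{i,j\}}$ for $i\in[2a]$, and - all differences $x_{\{i,j\}}\cdot x_{\{k,l\}}-x_{\{i,k\}}\cdot x_{\{j,l\}}$ for pairwise distinct $i,j,k,l\in[2a]$. Equivalently, $$\mathrm{gr}\,\mathbf{I}(\Pi_{(a^2)})=\mathrm{gr}\,\mathbf{I}(\Pi_{(2^a)})+\langle x_{\{i,j\}}\cdot x_{\{k,l\}}-x_{\{i,k\}}\cdot x_{\{j,l\}}: i,j,k,l\in[2a]\text{ are pairwise distinct}\rangle.$$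
   Context: Let $[n]=\{1,\dots,n\}$ and let $\binom{[n]}{2}$ be the set of 2-element subsets of $[n]$. Let $\mathbb{C}\big[\mathbf{x}_{\binom{[n]}{2}}\big]$ be the polynomial ring in the variables $x_{\{i,j\}}=x_{\{j,i\}}$ indexed by $\binom{[n]}{2}$; it is the coordinate ring of $\mathbb{C}^{\binom{[n]}{2}}$. An unordered set partition $\pi$ of $[n]$ is identified with the point $\mathbf{z}\in\mathbb{C}^{\binom{[n]}{2}}$ with $z_{\{i,j\}}=1$ if $i,j$ lie in the same block of $\pi$, and $z_{\{i,j\}}=0$ otherwise. $\Pi_{(2^a)}\subseteq\mathbb{C}^{\binom{[2a]}{2}}$ is the finite set of (points identified with) unordered set partitions of $[2a]$ into $a$ blocks of size $2$, and $\Pi_{(a^2)}\subseteq\mathbb{C}^{\binom{[2a]}{2}}$ is that of unordered set partitions of $[2a]$ into $2$ blocks of size $a$. For a finite set $\mathcal{Z}\subseteq\mathbb{C}^{\binom{[n]}{2}}$, $\mathbf{I}(\mathcal{Z})$ is the ideal of polynomials vanishing on $\mathcal{Z}$; for a nonzero polynomial $f$, $\tau(f)$ is its top-degree homogeneous component; $\mathrm{gr}\,\mathbf{I}(\mathcal{Z})=\langle\tau(f): 0\ne f\in\mathbf{I}(\mathcal{Z})\rangle$; and $R(\mathcal{Z})=\mathbb{C}\big[\mathbf{x}_{\binom{[n]}{2}}\big]/\mathrm{gr}\,\mathbf{I}(\mathcal{Z})$. *)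

theory Defs
  imports Complex_Main "HOL-Library.Poly_Mapping" "HOL-Library.Ramsey" "HOL-Library.Disjoint_Sets"
    "HOL-Algebra.Ideal"
begin

text \<open>
  A monomial is a finitely supported exponent function on variables, and a polynomial is a finitely
  supported coefficient function on monomials; ring operations on polynomials are those of
  \<^theory>\<open>HOL-Library.Poly_Mapping\<close> (convolution product). The variables are labelled by
  sets of natural numbers; \<open>nsets {1..n} 2\<close> is the set of 2-element subsets of \<open>{1..n}\<close>.
\<close>

type_synonym monomial = "nat set \<Rightarrow>\<^sub>0 nat"
type_synonym cpoly = "monomial \<Rightarrow>\<^sub>0 complex"

definition var :: "nat set \<Rightarrow> cpoly" where
  "var S = Poly_Mapping.single (Poly_Mapping.single S 1) 1"

definition poly_ring :: "nat \<Rightarrow> cpoly ring" where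
  "poly_ring n =
     \<lparr>carrier = {f. \<forall>m \<in> Poly_Mapping.keys f. Poly_Mapping.keys m \<subseteq> nsets {1..n} 2},
      mult = (*), one = 1, zero = 0, add = (+)\<rparr>"

definition eval_poly :: "(nat set \<Rightarrow> complex) \<Rightarrow> cpoly \<Rightarrow> complex" where
  "eval_poly z f =
     (\<Sum>m \<in> Poly_Mapping.keys f. Poly_Mapping.lookup f m *
        (\<Prod>S \<in> Poly_Mapping.keys m. z S ^ Poly_Mapping.lookup m S))"

definition monom_degree :: "monomial \<Rightarrow> nat" where
  "monom_degree m = (\<Sum>S \<in> Poly_Mapping.keys m. Poly_Mapping.lookup m S)"

text \<open>Only meaningful for nonzero polynomials.\<close>
definition total_degree :: "cpoly \<Rightarrow> nat" where
  "total_degree f = Max (monom_degree ` Poly_Mapping.keys f)"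

definition top_component :: "cpoly \<Rightarrow> cpoly" where
  "top_component f =
     (\<Sum>m \<in> {m \<in> Poly_Mapping.keys f. monom_degree m = total_degree f}.
        Poly_Mapping.single m (Poly_Mapping.lookup f m))"

text \<open>
  Points of affine space are functions on \<open>nsets {1..n} 2\<close>, extended by
  \<^const>\<open>undefined\<close>; polynomials in \<open>poly_ring n\<close> do not see the extension.
\<close>

definition vanishing_ideal :: "nat \<Rightarrow> (nat set \<Rightarrow> complex) set \<Rightarrow> cpoly set" where
  "vanishing_ideal n Z = {f \<in> carrier (poly_ring n). \<forall>z \<in> Z. eval_poly z f = 0}"

definition gr_ideal :: "nat \<Rightarrow> (nat set \<Rightarrow> complex) set \<Rightarrow> cpoly set" where
  "gr_ideal n Z = Idl\<^bsub>poly_ring n\<^esub> {top_component f | f. f \<in> vanishing_ideal n Z \<and> f \<noteq> 0}"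

definition partition_point :: "nat \<Rightarrow> nat set set \<Rightarrow> nat set \<Rightarrow> complex" where
  "partition_point n P = (\<lambda>S \<in> nsets {1..n} 2. if \<exists>B \<in> P. S \<subseteq> B then 1 else 0)"

text \<open>Set partitions of \<open>{1..k * b}\<close> into \<open>k\<close> blocks of size \<open>b\<close>.\<close>
definition uniform_locus :: "nat \<Rightarrow> nat \<Rightarrow> (nat set \<Rightarrow> complex) set" where
  "uniform_locus k b = partition_point (k * b) `
     {P. partition_on {1..k * b} P \<and> card P = k \<and> (\<forall>B \<in> P. card B = b)}"

text \<open>\<open>matching_locus a\<close> is the locus for the type \<open>(2, ..., 2)\<close>, \<open>halves_locus a\<close> that for \<open>(a, a)\<close>.\<close>
definition matching_locus :: "nat \<Rightarrow> (nat set \<Rightarrow> complex) set" where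
  "matching_locus a = uniform_locus a 2"

definition halves_locus :: "nat \<Rightarrow> (nat set \<Rightarrow> complex) set" where
  "halves_locus a = uniform_locus 2 a"

definition product_gens :: "nat \<Rightarrow> cpoly set" where
  "product_gens n =
     {var S * var T | S T. S \<in> nsets {1..n} 2 \<and> T \<in> nsets {1..n} 2 \<and> S \<inter> T \<noteq> {}}"

definition sum_gens :: "nat \<Rightarrow> cpoly set" where
  "sum_gens n = {\<Sum>j \<in> {1..n} - {i}. var {i, j} | i. i \<in> {1..n}}"

definition difference_gens :: "nat \<Rightarrow> cpoly set" where
  "difference_gens n =
     {var {i, j} * var {k, l} - var {i, k} * var {j, l} | i j k l.
        {i, j, k, l} \<subseteq> {1..n} \<and> distinct [i, j, k, l]}"

lemma poly_ring_simps:
  "f \<in> carrier (poly_ring n) \<longleftrightarrow>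
     (\<forall>m \<in> Poly_Mapping.keys f. Poly_Mapping.keys m \<subseteq> nsets {1..n} 2)"
  "f \<otimes>\<^bsub>poly_ring n\<^esub> g = f * g" "\<one>\<^bsub>poly_ring n\<^esub> = 1"
  "f \<oplus>\<^bsub>poly_ring n\<^esub> g = f + g" "\<zero>\<^bsub>poly_ring n\<^esub> = 0"
  by (simp_all add: poly_ring_def)

lemma poly_ring_closed:
  assumes "f \<in> carrier (poly_ring n)" "g \<in> carrier (poly_ring n)"
  shows "f + g \<in> carrier (poly_ring n)" "f * g \<in> carrier (poly_ring n)"
    "- f \<in> carrier (poly_ring n)"
proof -
  show "f + g \<in> carrier (poly_ring n)"
    using assms Poly_Mapping.keys_add[of f g] unfolding poly_ring_simps by blast
  show "- f \<in> carrier (poly_ring n)"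
    using assms(1) by (simp add: poly_ring_simps in_keys_iff)
  show "f * g \<in> carrier (poly_ring n)"
    unfolding poly_ring_simps
  proof
    fix m assume "m \<in> Poly_Mapping.keys (f * g)"
    then obtain p q where "m = p + q" "p \<in> Poly_Mapping.keys f" "q \<in> Poly_Mapping.keys g"
      using keys_mult[of f g] by blast
    then show "Poly_Mapping.keys m \<subseteq> nsets {1..n} 2"
      using assms Poly_Mapping.keys_add[of p q] unfolding poly_ring_simps by blast
  qed
qed

lemma cring_poly_ring: "cring (poly_ring n)"
proof (rule cringI)
  show "abelian_group (poly_ring n)"
  proof (rule abelian_groupI)
    fix f assume f: "f \<in> carrier (poly_ring n)"
    show "\<exists>g \<in> carrier (poly_ring n). g \<oplus>\<^bsub>poly_ring n\<^esub> f = \<zero>\<^bsub>poly_ring n\<^esub>"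
      by (rule bexI[OF _ poly_ring_closed(3)[OF f f]]) (simp add: poly_ring_simps)
  qed (simp_all add: poly_ring_simps(2-5) poly_ring_closed(1,2) ac_simps,
       simp add: poly_ring_simps)
  show "comm_monoid (poly_ring n)"
    by (rule comm_monoidI)
      (simp_all add: poly_ring_simps(2-5) poly_ring_closed(1,2) ac_simps,
       simp add: poly_ring_simps)
qed (simp add: poly_ring_simps(2-5) distrib_right)

end

theory Submission
  imports Defs
begin

text \<open>
  Let \<open>N = {1..2 * a}\<close>, and let \<open>J\<close> be the ideal generated by the three families. Each generator is
  the top component of a relation that holds on the points: a point coming from a halving
  \<open>N = X \<union> (N - X)\<close> has coordinates \<open>z {i, j} = (1 + e i * e j) / 2\<close> for signs \<open>e\<close> with sum \<open>0\<close>, and for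
  these \<open>z S * z T\<close> with \<open>S \<inter> T \<noteq> {}\<close>, the star sums and \<open>z {i, j} * z {k, l} - z {i, k} * z {j, l}\<close>
  are all equal to expressions of smaller degree (\<open>gens_in_gr_halves\<close>). The first two families also come
  from relations on the perfect matchings (\<open>gens_in_gr_matching\<close>). What remains is that both graded
  ideals are contained in \<open>J\<close>: if \<open>f\<close> has degree at most \<open>d\<close> and vanishes on one of the loci, then its
  component of degree \<open>d\<close> is in \<open>J\<close>.

  Modulo \<open>J\<close>, a monomial of degree \<open>d\<close> is either \<open>0\<close> or the product of the edges of a matching,
  and by the difference relations this product depends only on the set \<open>A\<close> of the \<open>2 * d\<close> matched
  vertices (\<open>matchings_eqv\<close>). Write \<open>y A\<close> for it here; it is \<open>set_monomial A\<close> below.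
  Multiplying a star sum by some \<open>y B\<close> shows that
  \<open>\<Sum>j \<in> N - C. y (insert j C)\<close> is \<open>0\<close> for every set \<open>C\<close> of odd size (\<open>up_relation\<close>). Hence, for
  \<open>k = 2 * d\<close> and by inclusion-exclusion, the sum of \<open>y A\<close> over all \<open>k\<close>-sets \<open>A\<close> disjoint from \<open>V\<close> is \<open>0\<close>
  if \<open>card V < k\<close> and \<open>y V\<close> if \<open>card V = k\<close> (\<open>superset_sum_eqv\<close>). For \<open>k > a\<close> the latter sum is empty,
  so \<open>y V\<close> is \<open>0\<close>.

  Now attach to each halving the polynomial \<open>\<Sum>A. y A\<close> over the \<open>k\<close>-subsets \<open>A\<close> of \<open>X\<close>, and let
  \<open>pairing k g\<close> be the sum of these over all \<open>X\<close>, weighted by \<open>g X\<close>. Suppose \<open>k \<le> a\<close>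
  and \<open>card B \<le> k\<close>. For the function \<open>g\<close> that indicates \<open>B \<inter> X = {}\<close>, the pairing is a positive
  multiple of the sum over the \<open>k\<close>-sets disjoint from \<open>B\<close>, hence \<open>0\<close> for
  \<open>card B < k\<close> and a multiple of \<open>y B\<close> for \<open>card B = k\<close>. The value of a monomial \<open>m\<close> at the point of \<open>X\<close>
  is a product, over the edges of \<open>m\<close>, of combinations of such indicators. So the pairing with a
  monomial of degree \<open>d\<close> reproduces it up to a nonzero factor, while monomials of smaller
  degree are killed (\<open>pairing_monomial\<close>). Pairing with the values of \<open>f\<close>, which are all \<open>0\<close>,
  puts the degree \<open>d\<close> component of \<open>f\<close> into \<open>J\<close> (\<open>hom_component_in_J\<close>).

  The same argument covers the perfect matchings. For fixed \<open>X\<close>, sum the values of \<open>m\<close> over the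
  matchings in which every edge joins \<open>X\<close> to \<open>N - X\<close>. If \<open>r\<close> distinct edges occur in \<open>m\<close>, this
  gives \<open>fact (a - r)\<close> if they are pairwise disjoint and all cross from \<open>X\<close> to \<open>N - X\<close>, and \<open>0\<close> otherwise
  (\<open>sum_eval_monom_crossing_points\<close>), again a product over edges of combinations of indicators.
\<close>

section \<open>Homogeneous components and the associated graded ideal\<close>

definition eval_monom :: "(nat set \<Rightarrow> complex) \<Rightarrow> monomial \<Rightarrow> complex" where
  "eval_monom z m = (\<Prod>S \<in> Poly_Mapping.keys m. z S ^ Poly_Mapping.lookup m S)"

lemma eval_monom_superset:
  assumes "finite A" "Poly_Mapping.keys m \<subseteq> A"
  shows "eval_monom z m = (\<Prod>S \<in> A. z S ^ Poly_Mapping.lookup m S)"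
  unfolding eval_monom_def by (rule prod.mono_neutral_left) (use assms in \<open>auto simp: in_keys_iff\<close>)

lemma eval_monom_add: "eval_monom z (p + q) = eval_monom z p * eval_monom z q"
proof -
  let ?A = "Poly_Mapping.keys p \<union> Poly_Mapping.keys q"
  have "Poly_Mapping.keys (p + q) \<subseteq> ?A" by (rule Poly_Mapping.keys_add)
  then show ?thesis
    by (simp add: eval_monom_superset[of ?A] lookup_add power_add prod.distrib)
qed

lemma eval_monom_0 [simp]: "eval_monom z 0 = 1"
  by (simp add: eval_monom_def)

lemma eval_monom_single [simp]: "eval_monom z (Poly_Mapping.single S k) = z S ^ k"
  by (simp add: eval_monom_def)

lemma monom_degree_superset:
  assumes "finite A" "Poly_Mapping.keys m \<subseteq> A"
  shows "monom_degree m = (\<Sum>S \<in> A. Poly_Mapping.lookup m S)"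
  unfolding monom_degree_def
  by (rule sum.mono_neutral_left) (use assms in \<open>auto simp: in_keys_iff\<close>)

lemma monom_degree_add: "monom_degree (p + q) = monom_degree p + monom_degree q"
proof -
  let ?A = "Poly_Mapping.keys p \<union> Poly_Mapping.keys q"
  have "Poly_Mapping.keys (p + q) \<subseteq> ?A" by (rule Poly_Mapping.keys_add)
  then show ?thesis
    by (simp add: monom_degree_superset[of ?A] lookup_add sum.distrib)
qed

lemma monom_degree_0 [simp]: "monom_degree 0 = 0"
  by (simp add: monom_degree_def)

lemma monom_degree_single [simp]: "monom_degree (Poly_Mapping.single S k) = k"
  by (simp add: monom_degree_def)

lemma eval_poly_superset:
  assumes "finite A" "Poly_Mapping.keys f \<subseteq> A"
  shows "eval_poly z f = (\<Sum>m \<in> A. Poly_Mapping.lookup f m * eval_monom z m)"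
  unfolding eval_poly_def eval_monom_def
  by (rule sum.mono_neutral_left) (use assms in \<open>auto simp: in_keys_iff\<close>)

lemma eval_poly_add: "eval_poly z (f + g) = eval_poly z f + eval_poly z g"
proof -
  let ?A = "Poly_Mapping.keys f \<union> Poly_Mapping.keys g"
  have "Poly_Mapping.keys (f + g) \<subseteq> ?A" by (rule Poly_Mapping.keys_add)
  then show ?thesis
    by (simp add: eval_poly_superset[of ?A] lookup_add sum.distrib distrib_right)
qed

lemma eval_poly_single [simp]: "eval_poly z (Poly_Mapping.single m c) = c * eval_monom z m"
  by (simp add: eval_poly_def eval_monom_def)

definition const :: "complex \<Rightarrow> cpoly" where
  "const c = Poly_Mapping.single 0 c"

lemma lookup_const_mult: "Poly_Mapping.lookup (const c * f) m = c * Poly_Mapping.lookup f m"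
  unfolding const_def mult_map_scale_conv_mult[symmetric]
  by (auto simp: Poly_Mapping.map.rep_eq when_def)

lemma keys_const_mult: "Poly_Mapping.keys (const c * f) \<subseteq> Poly_Mapping.keys f"
  by (auto simp: in_keys_iff lookup_const_mult)

lemma const_add: "const (c + d) = const c + const d"
  by (simp add: const_def single_add)

lemma const_mult: "const (c * d) = const c * const d"
  by (simp add: const_def mult_single)

lemma const_0 [simp]: "const 0 = 0"
  by (simp add: const_def)

lemma const_1 [simp]: "const 1 = 1"
  by (simp add: const_def)

lemma const_uminus: "const (- c) = - const c"
  by (simp add: const_def single_uminus)

lemma const_sum: "const (\<Sum>i\<in>A. c i) = (\<Sum>i\<in>A. const (c i))"
  by (induction A rule: infinite_finite_induct) (auto simp: const_add)

lemma eval_poly_const_mult: "eval_poly z (const c * f) = c * eval_poly z f"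
  unfolding eval_poly_superset[OF finite_keys keys_const_mult]
  by (simp add: lookup_const_mult eval_poly_superset[OF _ subset_refl] sum_distrib_left mult.assoc)

lemma eval_poly_0 [simp]: "eval_poly z 0 = 0"
  by (simp add: eval_poly_def)

lemma eval_poly_const [simp]: "eval_poly z (const c) = c"
  by (simp add: const_def)

lemma eval_poly_diff: "eval_poly z (f - g) = eval_poly z f - eval_poly z g"
  using eval_poly_add[of z "f - g" g] by simp

lemma eval_poly_sum: "eval_poly z (\<Sum>i\<in>A. f i) = (\<Sum>i\<in>A. eval_poly z (f i))"
  by (induction A rule: infinite_finite_induct) (auto simp: eval_poly_add)

lemma eval_poly_var [simp]: "eval_poly z (var S) = z S"
  by (simp add: var_def)

lemma var_mult_var:
  "var S * var T = Poly_Mapping.single (Poly_Mapping.single S 1 + Poly_Mapping.single T 1) 1"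
  by (simp add: var_def mult_single)

lemma eval_poly_var_mult [simp]: "eval_poly z (var S * var T) = z S * z T"
  by (simp add: var_mult_var eval_monom_add)

text \<open>
  In contrast to the top component, this makes sense in every degree and is linear in the polynomial.
\<close>

definition hom_component :: "nat \<Rightarrow> cpoly \<Rightarrow> cpoly" where
  "hom_component d f =
     (\<Sum>m \<in> {m \<in> Poly_Mapping.keys f. monom_degree m = d}.
        Poly_Mapping.single m (Poly_Mapping.lookup f m))"

lemma top_component_eq: "top_component f = hom_component (total_degree f) f"
  by (simp add: top_component_def hom_component_def)

lemma lookup_hom_component:
  "Poly_Mapping.lookup (hom_component d f) m = (if monom_degree m = d then Poly_Mapping.lookup f m else 0)"
proof -
  have "Poly_Mapping.lookup (hom_component d f) m =
    (\<Sum>q \<in> {q \<in> Poly_Mapping.keys f. monom_degree q = d}. if q = m then Poly_Mapping.lookup f m else 0)"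
    unfolding hom_component_def lookup_sum
    by (rule sum.cong) (auto simp: lookup_single when_def)
  also have "\<dots> = (if monom_degree m = d then Poly_Mapping.lookup f m else 0)"
    by (auto simp: in_keys_iff)
  finally show ?thesis .
qed

lemma hom_component_add: "hom_component d (f + g) = hom_component d f + hom_component d g"
  by (rule poly_mapping_eqI) (simp add: lookup_hom_component lookup_add)

lemma hom_component_diff: "hom_component d (f - g) = hom_component d f - hom_component d g"
  by (rule poly_mapping_eqI) (simp add: lookup_hom_component lookup_minus)

lemma hom_component_sum: "hom_component d (\<Sum>i\<in>A. f i) = (\<Sum>i\<in>A. hom_component d (f i))"
  by (rule poly_mapping_eqI) (simp add: lookup_hom_component lookup_sum)

lemma hom_component_single:
  "hom_component d (Poly_Mapping.single m c) = (if monom_degree m = d then Poly_Mapping.single m c else 0)"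
  by (rule poly_mapping_eqI) (auto simp: lookup_hom_component lookup_single when_def)

lemma hom_component_var: "hom_component d (var S) = (if d = 1 then var S else 0)"
  by (simp add: var_def hom_component_single)

lemma hom_component_var_mult: "hom_component d (var S * var T) = (if d = 2 then var S * var T else 0)"
  by (simp add: var_mult_var hom_component_single monom_degree_add)

lemma hom_component_const_mult: "hom_component d (const c * f) = const c * hom_component d f"
  by (rule poly_mapping_eqI) (simp add: lookup_hom_component lookup_const_mult)

lemma hom_component_const: "hom_component d (const c) = (if d = 0 then const c else 0)"
  by (simp add: const_def hom_component_single)

definition degree_le :: "cpoly \<Rightarrow> nat \<Rightarrow> bool" where
  "degree_le f d \<longleftrightarrow> (\<forall>m \<in> Poly_Mapping.keys f. monom_degree m \<le> d)"

lemma degree_le_add: "degree_le f d \<Longrightarrow> degree_le g d \<Longrightarrow> degree_le (f + g) d"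
  using Poly_Mapping.keys_add[of f g] unfolding degree_le_def by blast

lemma degree_le_diff: "degree_le f d \<Longrightarrow> degree_le g d \<Longrightarrow> degree_le (f - g) d"
  using keys_diff[of f g] unfolding degree_le_def by blast

lemma degree_le_sum: "(\<And>i. i \<in> A \<Longrightarrow> degree_le (f i) d) \<Longrightarrow> degree_le (\<Sum>i\<in>A. f i) d"
  by (induction A rule: infinite_finite_induct) (auto simp: degree_le_add, auto simp: degree_le_def)

lemma degree_le_single: "monom_degree m \<le> d \<Longrightarrow> degree_le (Poly_Mapping.single m c) d"
  by (simp add: degree_le_def)

lemma degree_le_const_mult: "degree_le f d \<Longrightarrow> degree_le (const c * f) d"
  using keys_const_mult[of c f] by (auto simp: degree_le_def)

lemma degree_le_const: "degree_le (const c) d"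
  by (simp add: const_def degree_le_single)

lemma degree_le_var: "1 \<le> d \<Longrightarrow> degree_le (var S) d"
  by (simp add: var_def degree_le_single)

lemma degree_le_var_mult: "2 \<le> d \<Longrightarrow> degree_le (var S * var T) d"
  by (simp add: var_mult_var degree_le_single monom_degree_add)

lemma poly_ring_single:
  "Poly_Mapping.keys m \<subseteq> nsets {1..n} 2 \<Longrightarrow> Poly_Mapping.single m c \<in> carrier (poly_ring n)"
  by (simp add: poly_ring_simps)

lemma poly_ring_const [simp]: "const c \<in> carrier (poly_ring n)"
  by (simp add: const_def poly_ring_single)

lemma poly_ring_var: "S \<in> nsets {1..n} 2 \<Longrightarrow> var S \<in> carrier (poly_ring n)"
  by (simp add: var_def poly_ring_single)

lemma poly_ring_0 [simp]: "0 \<in> carrier (poly_ring n)"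
  by (simp add: poly_ring_simps)

lemma poly_ring_1 [simp]: "1 \<in> carrier (poly_ring n)"
  by (simp add: poly_ring_simps)

lemma poly_ring_diff:
  "f \<in> carrier (poly_ring n) \<Longrightarrow> g \<in> carrier (poly_ring n) \<Longrightarrow> f - g \<in> carrier (poly_ring n)"
  using poly_ring_closed(1)[OF _ poly_ring_closed(3)] by fastforce

lemma poly_ring_sum:
  "(\<And>i. i \<in> A \<Longrightarrow> f i \<in> carrier (poly_ring n)) \<Longrightarrow> (\<Sum>i\<in>A. f i) \<in> carrier (poly_ring n)"
  by (induction A rule: infinite_finite_induct) (auto simp: poly_ring_closed(1))

lemma poly_ring_prod:
  "(\<And>i. i \<in> A \<Longrightarrow> f i \<in> carrier (poly_ring n)) \<Longrightarrow> (\<Prod>i\<in>A. f i) \<in> carrier (poly_ring n)"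
  by (induction A rule: infinite_finite_induct) (auto simp: poly_ring_closed(2))

lemma poly_ring_hom_component:
  "f \<in> carrier (poly_ring n) \<Longrightarrow> hom_component d f \<in> carrier (poly_ring n)"
  unfolding poly_ring_simps by (metis in_keys_iff lookup_hom_component)

lemma gr_ideal_ideal: "ideal (gr_ideal n Z) (poly_ring n)"
proof -
  interpret cring "poly_ring n" by (rule cring_poly_ring)
  show ?thesis unfolding gr_ideal_def
    by (rule genideal_ideal) (auto simp: vanishing_ideal_def top_component_eq poly_ring_hom_component)
qed

text \<open>
  Allowing a degree bound \<open>d\<close> that is not attained costs nothing, since the component is then \<open>0\<close>;
  with the bound in place of the exact degree, no leading coefficient has to be shown nonzero.
\<close>

lemma hom_component_in_gr_ideal:
  assumes "f \<in> vanishing_ideal n Z" "degree_le f d"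
  shows "hom_component d f \<in> gr_ideal n Z"
proof (cases "hom_component d f = 0")
  case True
  interpret ideal "gr_ideal n Z" "poly_ring n" by (rule gr_ideal_ideal)
  show ?thesis using additive_subgroup.zero_closed[OF additive_subgroup_axioms] True by (simp add: poly_ring_simps)
next
  case False
  then obtain m where m: "Poly_Mapping.lookup (hom_component d f) m \<noteq> 0"
    by (metis lookup_zero poly_mapping_eqI)
  then have m: "m \<in> Poly_Mapping.keys f" "monom_degree m = d"
    by (auto simp: lookup_hom_component in_keys_iff split: if_splits)
  have "total_degree f = d"
    unfolding total_degree_def by (rule Max_eqI) (use m assms(2) in \<open>auto simp: degree_le_def\<close>)
  then have eq: "hom_component d f = top_component f" by (simp add: top_component_eq)
  interpret cring "poly_ring n" by (rule cring_poly_ring)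
  have "f \<noteq> 0" using m by auto
  then have "top_component f \<in> {top_component f | f. f \<in> vanishing_ideal n Z \<and> f \<noteq> 0}"
    using assms(1) by blast
  moreover have "{top_component f | f. f \<in> vanishing_ideal n Z \<and> f \<noteq> 0} \<subseteq> carrier (poly_ring n)"
    by (auto simp: vanishing_ideal_def top_component_eq poly_ring_hom_component)
  ultimately show ?thesis unfolding eq gr_ideal_def using genideal_self by blast
qed

lemma gr_ideal_leI:
  assumes "ideal K (poly_ring n)"
    and "\<And>f d. f \<in> vanishing_ideal n Z \<Longrightarrow> degree_le f d \<Longrightarrow> hom_component d f \<in> K"
  shows "gr_ideal n Z \<subseteq> K"
proof -
  interpret cring "poly_ring n" by (rule cring_poly_ring)
  have "degree_le f (total_degree f)" for f
    by (auto simp: degree_le_def total_degree_def)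
  with assms show ?thesis unfolding gr_ideal_def
    by (intro genideal_minimal) (auto simp: top_component_eq)
qed

section \<open>The generators lie in the graded ideals\<close>

lemma card_2_obtain_other:
  assumes "card S = 2" "i \<in> S"
  obtains j where "S = {i, j}" "j \<noteq> i"
  using assms by (metis card_2_iff doubleton_eq_iff insertE singletonD)

definition cut_point :: "nat \<Rightarrow> nat set \<Rightarrow> nat set \<Rightarrow> complex" where
  "cut_point n X = (\<lambda>S \<in> nsets {1..n} 2. if S \<subseteq> X \<or> S \<inter> X = {} then 1 else 0)"

lemma cut_point_pair:
  "i \<in> {1..n} \<Longrightarrow> j \<in> {1..n} \<Longrightarrow> i \<noteq> j \<Longrightarrow>
    cut_point n X {i, j} = (if i \<in> X \<longleftrightarrow> j \<in> X then 1 else 0)"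
  by (auto simp: cut_point_def)

lemma partition_point_two_blocks:
  assumes "X \<subseteq> {1..n}"
  shows "partition_point n {X, {1..n} - X} = cut_point n X"
  unfolding partition_point_def cut_point_def
  by (rule restrict_ext) (use assms in \<open>auto simp: nsets_def\<close>)

lemma halves_locus_eq:
  assumes "a \<ge> 1"
  shows "halves_locus a = cut_point (2 * a) ` nsets {1..2 * a} a"
proof (intro equalityI subsetI)
  fix z assume "z \<in> halves_locus a"
  then obtain P where P: "z = partition_point (2 * a) P" "partition_on {1..2 * a} P"
      "card P = 2" "\<forall>B \<in> P. card B = a"
    by (auto simp: halves_locus_def uniform_locus_def)
  from P(3) obtain X Y where XY: "P = {X, Y}" "X \<noteq> Y" by (auto simp: card_2_iff)
  with P(2) have "X \<union> Y = {1..2 * a}" "X \<inter> Y = {}"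
    by (auto simp: partition_on_def disjoint_def)
  then have "X \<subseteq> {1..2 * a}" "Y = {1..2 * a} - X" by auto
  then show "z \<in> cut_point (2 * a) ` nsets {1..2 * a} a"
    using P XY partition_point_two_blocks[of X "2 * a"]
    by (auto simp: nsets_def intro: finite_subset)
next
  fix z assume "z \<in> cut_point (2 * a) ` nsets {1..2 * a} a"
  then obtain X where X: "X \<subseteq> {1..2 * a}" "card X = a" "z = cut_point (2 * a) X"
    by (auto simp: nsets_def)
  let ?Y = "{1..2 * a} - X"
  have cY: "card ?Y = a" using X by (simp add: card_Diff_subset finite_subset[OF X(1)])
  have "X \<noteq> {}" "?Y \<noteq> {}" using X cY assms by (metis card.empty not_one_le_zero)+
  then have "partition_on {1..2 * a} {X, ?Y}" "card {X, ?Y} = 2"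
    using X(1) by (auto simp: partition_on_def disjoint_def card_2_iff)
  then show "z \<in> halves_locus a"
    using X cY partition_point_two_blocks[OF X(1)]
    unfolding halves_locus_def uniform_locus_def
    by (intro image_eqI[of _ _ "{X, ?Y}"]) auto
qed

lemma matching_locusE:
  assumes "z \<in> matching_locus a"
  obtains P where "partition_on {1..2 * a} P" "\<forall>B \<in> P. card B = 2"
    "\<forall>S \<in> nsets {1..2 * a} 2. z S = (if S \<in> P then 1 else 0)"
proof -
  from assms obtain P where P: "z = partition_point (2 * a) P" "partition_on {1..2 * a} P"
      "\<forall>B \<in> P. card B = 2"
    by (auto simp: matching_locus_def uniform_locus_def mult.commute)
  have "z S = (if S \<in> P then 1 else 0)" if "S \<in> nsets {1..2 * a} 2" for S
  proof -
    have "S = B" if "B \<in> P" "S \<subseteq> B" for B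
      using \<open>S \<in> nsets _ 2\<close> P(3) that
      by (intro card_subset_eq) (auto simp: nsets_def card_ge_0_finite)
    then show ?thesis using that by (auto simp: P(1) partition_point_def)
  qed
  then show ?thesis using that P by blast
qed

lemma product_gens_carrier: "product_gens n \<subseteq> carrier (poly_ring n)"
  by (auto simp: product_gens_def intro!: poly_ring_closed(2) poly_ring_var)

lemma sum_gens_carrier: "sum_gens n \<subseteq> carrier (poly_ring n)"
  by (auto simp: sum_gens_def intro!: poly_ring_sum poly_ring_var)

lemma difference_gens_carrier: "difference_gens n \<subseteq> carrier (poly_ring n)"
  by (auto simp: difference_gens_def intro!: poly_ring_diff poly_ring_closed(2) poly_ring_var)

text \<open>
  A form that agrees on \<open>Z\<close> with a polynomial of smaller degree is a leading form of the ideal of \<open>Z\<close>.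
\<close>

lemma leading_form_in_gr_ideal:
  assumes "h \<in> carrier (poly_ring n)" "l \<in> carrier (poly_ring n)"
    and "\<And>z. z \<in> Z \<Longrightarrow> eval_poly z h = eval_poly z l"
    and "degree_le h d" "hom_component d h = h" "degree_le l d" "hom_component d l = 0"
  shows "h \<in> gr_ideal n Z"
proof -
  have "h - l \<in> vanishing_ideal n Z"
    using assms(1-3) by (simp add: vanishing_ideal_def poly_ring_diff eval_poly_diff)
  from hom_component_in_gr_ideal[OF this degree_le_diff[OF assms(4,6)]] assms(5,7)
  show ?thesis by (simp add: hom_component_diff)
qed

text \<open>
  On a perfect matching, distinct intersecting edges are never both present, a coordinate is its own
  square, and each vertex is on exactly one edge.
\<close>

lemma gens_in_gr_matching: "product_gens (2 * a) \<union> sum_gens (2 * a) \<subseteq> gr_ideal (2 * a) (matching_locus a)"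
proof -
  let ?n = "2 * a" and ?Z = "matching_locus a"
  have "var S * var T \<in> gr_ideal ?n ?Z"
    if ST: "S \<in> nsets {1..?n} 2" "T \<in> nsets {1..?n} 2" "S \<inter> T \<noteq> {}" for S T
  proof (rule leading_form_in_gr_ideal[where d = 2 and l = "if S = T then var S else 0"])
    fix z assume "z \<in> ?Z"
    then obtain P where P: "partition_on {1..2 * a} P"
      "\<forall>S \<in> nsets {1..2 * a} 2. z S = (if S \<in> P then 1 else 0)"
      by (rule matching_locusE)
    have "S = T" if "S \<in> P" "T \<in> P"
      using that P(1) ST(3) unfolding partition_on_def disjoint_def by blast
    then show "eval_poly z (var S * var T) = eval_poly z (if S = T then var S else 0)"
      using P(2) ST by auto
  qed (use ST in \<open>auto simp: hom_component_var_mult hom_component_var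
        intro!: poly_ring_closed(2) poly_ring_var degree_le_var degree_le_var_mult,
        auto simp: hom_component_def degree_le_def\<close>)
  moreover have "(\<Sum>j \<in> {1..?n} - {i}. var {i, j}) \<in> gr_ideal ?n ?Z" if i: "i \<in> {1..?n}" for i
  proof (rule leading_form_in_gr_ideal[where d = 1 and l = 1])
    fix z assume "z \<in> ?Z"
    then obtain P where P: "partition_on {1..2 * a} P" "\<forall>B \<in> P. card B = 2"
      "\<forall>S \<in> nsets {1..2 * a} 2. z S = (if S \<in> P then 1 else 0)"
      by (rule matching_locusE)
    obtain B where B: "B \<in> P" "i \<in> B" using P(1) i unfolding partition_on_def by blast
    then obtain k where k: "B = {i, k}" "k \<noteq> i" using P(2) card_2_obtain_other by metis
    have kn: "k \<in> {1..?n}" using P(1) B k by (auto simp: partition_on_def)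
    have eq: "{i, j} \<in> P \<longleftrightarrow> j = k" if "j \<noteq> i" for j
    proof
      assume "{i, j} \<in> P"
      moreover have "{i, j} \<inter> {i, k} \<noteq> {}" by blast
      moreover have "disjoint P" using P(1) by (simp add: partition_on_def)
      ultimately have "{i, j} = {i, k}" using B(1) unfolding k(1) disjoint_def by metis
      then show "j = k" using that by (auto simp: doubleton_eq_iff)
    qed (use B k in auto)
    have "eval_poly z (\<Sum>j \<in> {1..?n} - {i}. var {i, j}) = (\<Sum>j \<in> {1..?n} - {i}. if j = k then 1 else 0)"
      unfolding eval_poly_sum eval_poly_var using P(3) i eq by (intro sum.cong) auto
    also have "\<dots> = 1" using kn k by simp
    also have "\<dots> = eval_poly z 1" using eval_poly_single[of z 0 1] by simp
    finally show "eval_poly z (\<Sum>j \<in> {1..?n} - {i}. var {i, j}) = eval_poly z 1" .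
  qed (use i in \<open>auto simp: hom_component_sum hom_component_var
        intro!: poly_ring_sum poly_ring_var degree_le_sum degree_le_var,
        auto simp: hom_component_def degree_le_def\<close>)
  ultimately show ?thesis by (auto simp: product_gens_def sum_gens_def)
qed

text \<open>
  For coordinates \<open>z {i, j} = (1 + e i * e j) / 2\<close> with signs \<open>e\<close>, the product \<open>z {i, j} * z {i, k}\<close> is
  affine in \<open>z\<close> because \<open>e i * e i = 1\<close>; in \<open>z {i, j} * z {k, l} - z {i, k} * z {j, l}\<close> the
  quartic terms \<open>e i * e j * e k * e l\<close> cancel. The star sum at \<open>i\<close> counts the other \<open>a - 1\<close> elements of
  the block of \<open>i\<close>.
\<close>

lemma gens_in_gr_halves:
  assumes "a \<ge> 1"
  shows "product_gens (2 * a) \<union> sum_gens (2 * a) \<union> difference_gens (2 * a)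
    \<subseteq> gr_ideal (2 * a) (halves_locus a)"
proof -
  let ?n = "2 * a" and ?Z = "halves_locus a"
  note Z = halves_locus_eq[OF assms]
  note comps = hom_component_var_mult hom_component_var hom_component_const_mult
    hom_component_const hom_component_add hom_component_diff hom_component_sum
  note closed = poly_ring_closed(1,2) poly_ring_diff poly_ring_sum poly_ring_var poly_ring_const
  note degs = degree_le_add degree_le_diff degree_le_sum degree_le_const_mult degree_le_const
    degree_le_var degree_le_var_mult
  have products: "var S * var T \<in> gr_ideal ?n ?Z"
    if ST: "S \<in> nsets {1..?n} 2" "T \<in> nsets {1..?n} 2" "S \<inter> T \<noteq> {}" for S T
  proof (cases "S = T")
    case True
    show ?thesis
    proof (rule leading_form_in_gr_ideal[where d = 2 and l = "var S"])
      fix z assume "z \<in> ?Z"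
      then show "eval_poly z (var S * var T) = eval_poly z (var S)"
        using True ST unfolding eval_poly_var_mult eval_poly_var Z cut_point_def by (auto split: if_splits)
    qed (use ST in \<open>auto simp: comps intro!: closed degs\<close>)
  next
    case False
    obtain i where i: "i \<in> S" "i \<in> T" using ST(3) by blast
    moreover have cards: "card S = 2" "card T = 2" using ST by (auto simp: nsets_def)
    ultimately obtain j k where jk: "S = {i, j}" "j \<noteq> i" "T = {i, k}" "k \<noteq> i"
      using card_2_obtain_other by metis
    have ijk: "S = {i, j}" "T = {i, k}" "i \<noteq> j" "i \<noteq> k" "j \<noteq> k"
      "i \<in> {1..?n}" "j \<in> {1..?n}" "k \<in> {1..?n}"
      using jk False ST by (auto simp: nsets_def)
    show ?thesis
    proof (rule leading_form_in_gr_ideal[where d = 2 and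
          l = "const (1/2) * (var {i, j} + var {i, k} + var {j, k} - const 1)"])
      fix z assume "z \<in> ?Z"
      then obtain X where X: "z = cut_point ?n X" by (auto simp: Z)
      show "eval_poly z (var S * var T) =
          eval_poly z (const (1/2) * (var {i, j} + var {i, k} + var {j, k} - const 1))"
        unfolding X ijk(1,2) eval_poly_var_mult eval_poly_const_mult eval_poly_add eval_poly_diff
          eval_poly_var eval_poly_const
        using ijk by (simp add: cut_point_pair del: atLeastAtMost_iff)
    qed (use ijk in \<open>auto simp: comps simp del: const_1 intro!: closed degs\<close>)
  qed
  have sums: "(\<Sum>j \<in> {1..?n} - {i}. var {i, j}) \<in> gr_ideal ?n ?Z" if i: "i \<in> {1..?n}" for i
  proof (rule leading_form_in_gr_ideal[where d = 1 and l = "const (of_nat (a - 1))"])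
    fix z assume "z \<in> ?Z"
    then obtain X where X: "z = cut_point ?n X" "X \<subseteq> {1..?n}" "card X = a" "finite X"
      by (auto simp: Z nsets_def)
    \<comment> \<open>the block of \<open>i\<close>\<close>
    define Y where "Y = (if i \<in> X then X else {1..?n} - X)"
    have Y: "card Y = a" "i \<in> Y" "Y \<subseteq> {1..?n}" "finite Y"
      using X i by (auto simp: Y_def card_Diff_subset)
    have "eval_poly z (\<Sum>j \<in> {1..?n} - {i}. var {i, j}) = (\<Sum>j \<in> {1..?n} - {i}. if j \<in> Y then 1 else 0)"
      unfolding eval_poly_sum eval_poly_var X(1)
    proof (rule sum.cong[OF refl])
      fix j assume "j \<in> {1..?n} - {i}"
      then show "cut_point ?n X {i, j} = (if j \<in> Y then 1 else 0)"
        using cut_point_pair[of i ?n j X] i by (auto simp: Y_def)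
    qed
    also have "\<dots> = of_nat (card (({1..?n} - {i}) \<inter> Y))"
      by (subst sum.inter_restrict[symmetric]) simp_all
    also have "card (({1..?n} - {i}) \<inter> Y) = a - 1"
    proof -
      have "({1..?n} - {i}) \<inter> Y = Y - {i}" using Y(3) by blast
      then show ?thesis using Y by simp
    qed
    finally show "eval_poly z (\<Sum>j \<in> {1..?n} - {i}. var {i, j}) = eval_poly z (const (of_nat (a - 1)))"
      by simp
  qed (use i in \<open>auto simp: comps intro!: closed degs\<close>)
  have differences: "var {i, j} * var {k, l} - var {i, k} * var {j, l} \<in> gr_ideal ?n ?Z"
    if ijkl: "{i, j, k, l} \<subseteq> {1..?n}" "distinct [i, j, k, l]" for i j k l
  proof (rule leading_form_in_gr_ideal[where d = 2 and
        l = "const (1/2) * (var {i, j} + var {k, l} - var {i, k} - var {j, l})"])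
    fix z assume "z \<in> ?Z"
    then obtain X where X: "z = cut_point ?n X" by (auto simp: Z)
    show "eval_poly z (var {i, j} * var {k, l} - var {i, k} * var {j, l}) =
        eval_poly z (const (1/2) * (var {i, j} + var {k, l} - var {i, k} - var {j, l}))"
      unfolding X eval_poly_var_mult eval_poly_const_mult eval_poly_add eval_poly_diff eval_poly_var
      using ijkl by (simp add: cut_point_pair del: atLeastAtMost_iff)
  qed (use ijkl in \<open>auto simp: comps intro!: closed degs\<close>)
  have "product_gens ?n \<subseteq> gr_ideal ?n ?Z" "sum_gens ?n \<subseteq> gr_ideal ?n ?Z"
    using products sums unfolding product_gens_def sum_gens_def by blast+
  moreover have "difference_gens ?n \<subseteq> gr_ideal ?n ?Z"
    unfolding difference_gens_def by clarify (rule differences)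
  ultimately show ?thesis by simp
qed

section \<open>Matching monomials modulo the relations\<close>

definition perfect_matching :: "nat set \<Rightarrow> nat set set \<Rightarrow> bool" where
  "perfect_matching A U \<longleftrightarrow> (\<forall>S \<in> U. card S = 2) \<and> disjoint U \<and> \<Union>U = A"

lemma perfect_matching_insert:
  assumes "perfect_matching A U" "card S = 2" "S \<inter> A = {}"
  shows "perfect_matching (S \<union> A) (insert S U)"
  using assms unfolding perfect_matching_def disjoint_def by auto

lemma perfect_matching_remove:
  assumes "perfect_matching A U" "S \<in> U"
  shows "perfect_matching (A - S) (U - {S})"
  using assms unfolding perfect_matching_def disjoint_def by blast

lemma perfect_matching_exists:
  assumes "finite A" "even (card A)"
  shows "\<exists>U. perfect_matching A U"
  using assms
proof (induction "card A" arbitrary: A rule: less_induct)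
  case less
  show ?case
  proof (cases "A = {}")
    case True
    then show ?thesis by (intro exI[of _ "{}"]) (simp add: perfect_matching_def)
  next
    case False
    then have "card A \<noteq> 0" "card A \<noteq> 1" using less.prems by auto
    then have ge2: "card A \<ge> 2" by linarith
    then obtain S where S: "S \<subseteq> A" "card S = 2"
      using less.prems(1) by (meson obtain_subset_with_card_n)
    then have "card (A - S) = card A - 2"
      using card_Diff_subset[OF finite_subset[OF S(1) less.prems(1)] S(1)] by simp
    then have "card (A - S) < card A" "even (card (A - S))" using ge2 less.prems(2) by simp_all
    then obtain U where "perfect_matching (A - S) U"
      using less.hyps[of "A - S"] less.prems(1) by blast
    then have "perfect_matching (S \<union> (A - S)) (insert S U)"
      using S by (intro perfect_matching_insert) auto
    then show ?thesis using S by (auto simp: Un_absorb1)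
  qed
qed

lemma perfect_matching_obtain_edge:
  assumes "perfect_matching A U" "i \<in> A"
  obtains j where "{i, j} \<in> U" "j \<noteq> i"
proof -
  from assms obtain S where "S \<in> U" "i \<in> S" "card S = 2"
    by (auto simp: perfect_matching_def)
  then show ?thesis using card_2_obtain_other that by metis
qed

lemma perfect_matching_finite: "perfect_matching A U \<Longrightarrow> finite A \<Longrightarrow> finite U"
  unfolding perfect_matching_def by (metis finite_UnionD)

definition edge_product :: "nat set set \<Rightarrow> cpoly" where
  "edge_product U = (\<Prod>S \<in> U. var S)"

locale relation_ideal =
  fixes a :: nat and J :: "cpoly set"
  assumes J_ideal: "ideal J (poly_ring (2 * a))"
    and products: "product_gens (2 * a) \<subseteq> J"
    and sums: "sum_gens (2 * a) \<subseteq> J"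
    and differences: "difference_gens (2 * a) \<subseteq> J"
begin

abbreviation N :: "nat set" where "N \<equiv> {1..2 * a}"
abbreviation R :: "cpoly set" where "R \<equiv> carrier (poly_ring (2 * a))"

lemma J_0 [simp]: "0 \<in> J"
  using additive_subgroup.zero_closed[OF ideal.axioms(1)[OF J_ideal]] by (simp add: poly_ring_simps)

lemma J_add: "f \<in> J \<Longrightarrow> g \<in> J \<Longrightarrow> f + g \<in> J"
  using additive_subgroup.a_closed[OF ideal.axioms(1)[OF J_ideal]] by (simp add: poly_ring_simps)

lemma J_mult: "f \<in> R \<Longrightarrow> g \<in> J \<Longrightarrow> f * g \<in> J"
  using ideal.I_l_closed[OF J_ideal] by (simp add: poly_ring_simps(2))

lemma J_const: "g \<in> J \<Longrightarrow> const c * g \<in> J"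
  by (simp add: J_mult)

lemma J_uminus: "f \<in> J \<Longrightarrow> - f \<in> J"
  using J_const[of f "- 1"] by (simp add: const_uminus)

lemma J_diff: "f \<in> J \<Longrightarrow> g \<in> J \<Longrightarrow> f - g \<in> J"
  using J_add[OF _ J_uminus] by fastforce

lemma J_sum: "(\<And>i. i \<in> A \<Longrightarrow> f i \<in> J) \<Longrightarrow> (\<Sum>i\<in>A. f i) \<in> J"
  by (induction A rule: infinite_finite_induct) (auto simp: J_add)

lemma J_const_cancel:
  assumes "const c * f \<in> J" "c \<noteq> 0"
  shows "f \<in> J"
  using J_const[OF assms(1), of "1 / c"] assms(2)
  by (simp add: mult.assoc[symmetric] const_mult[symmetric])

definition eqv :: "cpoly \<Rightarrow> cpoly \<Rightarrow> bool" (infix "\<simeq>" 50) where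
  "f \<simeq> g \<longleftrightarrow> f - g \<in> J"

lemma eqv_refl [simp]: "f \<simeq> f"
  by (simp add: eqv_def)

lemma eqv_sym: "f \<simeq> g \<Longrightarrow> g \<simeq> f"
  using J_uminus[of "f - g"] by (simp add: eqv_def)

lemma eqv_trans [trans]: "f \<simeq> g \<Longrightarrow> g \<simeq> h \<Longrightarrow> f \<simeq> h"
  using J_add[of "f - g" "g - h"] by (simp add: eqv_def)

lemma eqv_mult: "r \<in> R \<Longrightarrow> f \<simeq> g \<Longrightarrow> r * f \<simeq> r * g"
  using J_mult[of r "f - g"] by (simp add: eqv_def right_diff_distrib)

lemma eqv_const: "f \<simeq> g \<Longrightarrow> const c * f \<simeq> const c * g"
  by (simp add: eqv_mult)

lemma eqv_add: "f \<simeq> g \<Longrightarrow> f' \<simeq> g' \<Longrightarrow> f + f' \<simeq> g + g'"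
  using J_add[of "f - g" "f' - g'"] by (simp add: eqv_def algebra_simps)

lemma eqv_diff: "f \<simeq> g \<Longrightarrow> f' \<simeq> g' \<Longrightarrow> f - f' \<simeq> g - g'"
  using J_diff[of "f - g" "f' - g'"] by (simp add: eqv_def algebra_simps)

lemma eqv_sum: "(\<And>i. i \<in> A \<Longrightarrow> f i \<simeq> g i) \<Longrightarrow> (\<Sum>i\<in>A. f i) \<simeq> (\<Sum>i\<in>A. g i)"
  using J_sum[of A "\<lambda>i. f i - g i"] by (simp add: eqv_def sum_subtractf)

lemma eqv_0_iff: "f \<simeq> 0 \<longleftrightarrow> f \<in> J"
  by (simp add: eqv_def)

lemma eqv_J_iff: "f \<simeq> g \<Longrightarrow> f \<in> J \<longleftrightarrow> g \<in> J"
  by (metis eqv_0_iff eqv_sym eqv_trans)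

lemma meeting_product:
  "S \<in> nsets N 2 \<Longrightarrow> T \<in> nsets N 2 \<Longrightarrow> S \<inter> T \<noteq> {} \<Longrightarrow> var S * var T \<in> J"
  using products unfolding product_gens_def by blast

lemma switch:
  assumes "{i, j, k, l} \<subseteq> N" "distinct [i, j, k, l]"
  shows "var {i, j} * var {k, l} \<simeq> var {i, k} * var {j, l}"
  using differences assms unfolding difference_gens_def eqv_def by blast

lemma star_sum: "i \<in> N \<Longrightarrow> (\<Sum>j \<in> N - {i}. var {i, j}) \<in> J"
  using sums unfolding sum_gens_def by blast

lemma perfect_matching_edges:
  "perfect_matching A U \<Longrightarrow> A \<subseteq> N \<Longrightarrow> U \<subseteq> nsets N 2"
  by (auto simp: perfect_matching_def nsets_def card_ge_0_finite)

lemma edge_product_closed: "U \<subseteq> nsets N 2 \<Longrightarrow> edge_product U \<in> R"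
  unfolding edge_product_def by (intro poly_ring_prod poly_ring_var) auto

text \<open>
  Fix a vertex \<open>i\<close>. If the two matchings pair it with different vertices \<open>j\<close> and \<open>k\<close>, one switch of
  \<open>{i, j}, {k, l}\<close> into \<open>{i, k}, {j, l}\<close> makes them share the edge \<open>{i, k}\<close>; remove it and induct.
\<close>

lemma matchings_eqv:
  assumes "A \<subseteq> N" "perfect_matching A U" "perfect_matching A U'"
  shows "edge_product U \<simeq> edge_product U'"
  using assms
proof (induction "card A" arbitrary: A U U' rule: less_induct)
  case less
  have finA: "finite A" using less.prems(1) finite_subset by blast
  have fin: "finite U" "finite U'"
    using less.prems finA perfect_matching_finite by auto
  show ?case
  proof (cases "A = {}")
    case True
    have "U = {}" "U' = {}"
      using less.prems(2,3) unfolding True perfect_matching_def by fastforce+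
    then show ?thesis by simp
  next
    case False
    then obtain i where i: "i \<in> A" by blast
    obtain j where j: "{i, j} \<in> U" "j \<noteq> i" using perfect_matching_obtain_edge[OF less.prems(2) i] .
    obtain k where k: "{i, k} \<in> U'" "k \<noteq> i" using perfect_matching_obtain_edge[OF less.prems(3) i] .
    have jk: "j \<in> A" "k \<in> A" using j k less.prems(2,3) unfolding perfect_matching_def by blast+
    have smaller: "card (A - {i, k}) < card A"
      using i finA by (intro psubset_card_mono) auto
    have x: "var {i, k} \<in> R" using i jk k less.prems(1) by (intro poly_ring_var) auto
    have U': "edge_product U' = var {i, k} * edge_product (U' - {{i, k}})"
      unfolding edge_product_def using fin k by (simp add: prod.remove)
    note pm' = perfect_matching_remove[OF less.prems(3) k(1)]
    show ?thesis
    proof (cases "j = k")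
      case True
      have U: "edge_product U = var {i, k} * edge_product (U - {{i, k}})"
        unfolding edge_product_def using fin j True by (simp add: prod.remove)
      have "edge_product (U - {{i, k}}) \<simeq> edge_product (U' - {{i, k}})"
        using less.hyps[OF smaller _ _ pm'] less.prems(1) perfect_matching_remove[OF less.prems(2) j(1)] True
        by blast
      then show ?thesis unfolding U U' by (rule eqv_mult[OF x])
    next
      case False
      obtain l where l: "{k, l} \<in> U" "l \<noteq> k" using perfect_matching_obtain_edge[OF less.prems(2) jk(2)] .
      have "{i, j} \<inter> {k, l} = {}"
        using less.prems(2) j(1) l(1) k(2) False unfolding perfect_matching_def disjoint_def
        by (metis doubleton_eq_iff)
      then have dist: "distinct [i, j, k, l]" using j k l by auto
      have lA: "l \<in> A" using l less.prems(2) unfolding perfect_matching_def by blast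
      let ?W = "U - {{i, j}} - {{k, l}}"
      let ?V = "insert {j, l} ?W"
      have "perfect_matching (A - {i, j} - {k, l}) ?W"
        using dist j l
        by (intro perfect_matching_remove less.prems(2)) (auto simp: doubleton_eq_iff)
      then have "perfect_matching ({j, l} \<union> (A - {i, j} - {k, l})) ?V"
        using dist by (intro perfect_matching_insert) auto
      moreover have "{j, l} \<union> (A - {i, j} - {k, l}) = A - {i, k}"
        using dist jk lA by auto
      ultimately have pmV: "perfect_matching (A - {i, k}) ?V" by simp
      have W: "?W \<subseteq> nsets N 2" using perfect_matching_edges[OF less.prems(2,1)] by blast
      have "{j, l} \<notin> U"
        using less.prems(2) j(1) dist unfolding perfect_matching_def disjoint_def
        by (metis Int_iff doubleton_eq_iff empty_iff insertI1 insertI2 distinct_length_2_or_more)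
      then have V: "edge_product ?V = var {j, l} * edge_product ?W"
        unfolding edge_product_def using fin by simp
      have "edge_product U = var {i, j} * (var {k, l} * edge_product ?W)"
        unfolding edge_product_def using fin j l dist
        by (subst prod.remove[of U "{i, j}"], simp, simp, subst prod.remove[of _ "{k, l}"])
           (auto simp: doubleton_eq_iff)
      also have "\<dots> = edge_product ?W * (var {i, j} * var {k, l})" by (simp add: mult_ac)
      also have "\<dots> \<simeq> edge_product ?W * (var {i, k} * var {j, l})"
        using i jk lA less.prems(1) dist by (intro eqv_mult edge_product_closed W switch) auto
      also have "\<dots> = var {i, k} * edge_product ?V" unfolding V by (simp add: mult_ac)
      also have "\<dots> \<simeq> var {i, k} * edge_product (U' - {{i, k}})"
        using less.hyps[OF smaller _ pmV pm'] less.prems(1) by (intro eqv_mult x) auto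
      finally show ?thesis unfolding U' .
    qed
  qed
qed

text \<open>
  By the preceding lemma the choice of the matching does not matter modulo \<open>J\<close>.
\<close>

definition set_monomial :: "nat set \<Rightarrow> cpoly" where
  "set_monomial A = edge_product (SOME U. perfect_matching A U)"

lemma set_monomial_matching:
  assumes "A \<subseteq> N" "even (card A)"
  obtains U where "perfect_matching A U" "set_monomial A = edge_product U" "U \<subseteq> nsets N 2" "finite U"
proof -
  have fin: "finite A" using assms(1) finite_subset by blast
  have "perfect_matching A (SOME U. perfect_matching A U)"
    using perfect_matching_exists[OF fin assms(2)] by (rule someI_ex)
  then show ?thesis
    using that perfect_matching_edges[OF _ assms(1)] perfect_matching_finite[OF _ fin]
    unfolding set_monomial_def by blast
qed

lemma set_monomial_closed: "A \<subseteq> N \<Longrightarrow> even (card A) \<Longrightarrow> set_monomial A \<in> R"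
  by (metis set_monomial_matching edge_product_closed)

lemma set_monomial_empty [simp]: "set_monomial {} = 1"
proof -
  obtain U where U: "perfect_matching {} U" "set_monomial {} = edge_product U"
    using set_monomial_matching[of "{}"] by auto
  have "U = {}" using U(1) unfolding perfect_matching_def by fastforce
  then show ?thesis using U by (simp add: edge_product_def)
qed

lemma var_set_monomial_disjoint:
  assumes "S \<in> nsets N 2" "A \<subseteq> N" "even (card A)" "S \<inter> A = {}"
  shows "var S * set_monomial A \<simeq> set_monomial (S \<union> A)"
proof -
  obtain U where U: "perfect_matching A U" "set_monomial A = edge_product U" "finite U"
    using set_monomial_matching[OF assms(2,3)] .
  have S: "S \<subseteq> N" "card S = 2" "finite S" using assms(1) by (auto simp: nsets_def)
  have finA: "finite A" using assms(2) finite_subset by blast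
  have SA: "S \<union> A \<subseteq> N" "even (card (S \<union> A))"
    using S assms finA by (auto simp: card_Un_disjoint)
  obtain U' where U': "perfect_matching (S \<union> A) U'" "set_monomial (S \<union> A) = edge_product U'"
    using set_monomial_matching[OF SA] .
  have "S \<notin> U"
  proof
    assume "S \<in> U"
    then have "S \<subseteq> A" using U(1) by (auto simp: perfect_matching_def)
    then have "S = {}" using assms(4) by blast
    then show False using S(2) by simp
  qed
  then have "var S * set_monomial A = edge_product (insert S U)"
    unfolding U(2) edge_product_def using U(3) by simp
  also have "\<dots> \<simeq> edge_product U'"
    using matchings_eqv[OF SA(1) perfect_matching_insert[OF U(1) S(2) assms(4)] U'(1)] .
  finally show ?thesis unfolding U'(2) .
qed

lemma var_set_monomial_meeting:
  assumes "S \<in> nsets N 2" "A \<subseteq> N" "even (card A)" "S \<inter> A \<noteq> {}"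
  shows "var S * set_monomial A \<in> J"
proof -
  obtain U where U: "perfect_matching A U" "set_monomial A = edge_product U" "U \<subseteq> nsets N 2" "finite U"
    using set_monomial_matching[OF assms(2,3)] .
  then obtain T where T: "T \<in> U" "S \<inter> T \<noteq> {}"
    using assms(4) unfolding perfect_matching_def by blast
  have "set_monomial A = var T * edge_product (U - {T})"
    unfolding U(2) edge_product_def using U(4) T by (simp add: prod.remove)
  then have "var S * set_monomial A = edge_product (U - {T}) * (var S * var T)" by (simp add: mult_ac)
  also have "\<dots> \<in> J"
    using U(3) T assms(1) by (intro J_mult edge_product_closed meeting_product) auto
  finally show ?thesis .
qed

text \<open>
  For \<open>i \<in> C\<close>, multiply the star sum at \<open>i\<close> by the monomial of \<open>C - {i}\<close>: the edges from \<open>i\<close> into \<open>C\<close> meet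
  a matched vertex and drop out.
\<close>

lemma up_relation:
  assumes "C \<subseteq> N" "odd (card C)"
  shows "(\<Sum>j \<in> N - C. set_monomial (insert j C)) \<in> J"
proof -
  have finC: "finite C" using assms(1) finite_subset by blast
  obtain i where i: "i \<in> C" using assms(2) by fastforce
  let ?B = "C - {i}"
  have B: "?B \<subseteq> N" "even (card ?B)" using assms i finC by auto
  have "(\<Sum>j \<in> N - {i}. var {i, j} * set_monomial ?B) \<simeq> (\<Sum>j \<in> N - {i}. if j \<in> C then 0 else set_monomial (insert j C))"
  proof (rule eqv_sum)
    fix j assume j: "j \<in> N - {i}"
    have S: "{i, j} \<in> nsets N 2" using i j assms(1) by auto
    show "var {i, j} * set_monomial ?B \<simeq> (if j \<in> C then 0 else set_monomial (insert j C))"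
    proof (cases "j \<in> C")
      case True
      then show ?thesis using var_set_monomial_meeting[OF S B] j by (auto simp: eqv_0_iff)
    next
      case False
      moreover have "{i, j} \<union> ?B = insert j C" using i by blast
      ultimately show ?thesis using var_set_monomial_disjoint[OF S B] j by simp
    qed
  qed
  also have "(\<Sum>j \<in> N - {i}. if j \<in> C then 0 else set_monomial (insert j C)) = (\<Sum>j \<in> N - C. set_monomial (insert j C))"
    by (rule sum.mono_neutral_cong_right) (use i in auto)
  finally have eqv: "(\<Sum>j \<in> N - {i}. var {i, j} * set_monomial ?B) \<simeq> (\<Sum>j \<in> N - C. set_monomial (insert j C))" .
  have "(\<Sum>j \<in> N - {i}. var {i, j} * set_monomial ?B) = set_monomial ?B * (\<Sum>j \<in> N - {i}. var {i, j})"
    by (simp add: sum_distrib_left mult.commute)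
  also have "\<dots> \<in> J"
    using i assms(1) by (intro J_mult set_monomial_closed B star_sum) auto
  finally show ?thesis using eqv_J_iff[OF eqv] by blast
qed

end

section \<open>Sums over the sets that avoid given vertices\<close>

declare finite_imp_finite_nsets [simp]

text \<open>
  Each set \<open>A\<close> arises as \<open>insert j C\<close> once for every \<open>j \<in> A - D\<close>.
\<close>

lemma sum_over_extensions:
  fixes f :: "'b set \<Rightarrow> 'a :: comm_ring_1"
  assumes "finite M"
  shows "(\<Sum>C | C \<in> nsets M k \<and> D \<subseteq> C. \<Sum>j \<in> M - C. f (insert j C)) =
    of_nat (Suc k - card D) * (\<Sum>A | A \<in> nsets M (Suc k) \<and> D \<subseteq> A. f A)"
proof -
  have fin: "finite (nsets M k)" "finite (nsets M (Suc k))"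
    using assms by (auto intro: finite_imp_finite_nsets)
  have "(\<Sum>C | C \<in> nsets M k \<and> D \<subseteq> C. \<Sum>j \<in> M - C. f (insert j C)) =
    (\<Sum>(C, j) \<in> Sigma {C. C \<in> nsets M k \<and> D \<subseteq> C} (\<lambda>C. M - C). f (insert j C))"
    using assms fin by (intro sum.Sigma) auto
  also have "\<dots> = (\<Sum>(A, j) \<in> Sigma {A. A \<in> nsets M (Suc k) \<and> D \<subseteq> A} (\<lambda>A. A - D). f A)"
    by (rule sum.reindex_bij_witness[where i = "\<lambda>(A, j). (A - {j}, j)" and j = "\<lambda>(C, j). (insert j C, j)"])
       (auto simp: nsets_def insert_absorb)
  also have "\<dots> = (\<Sum>A | A \<in> nsets M (Suc k) \<and> D \<subseteq> A. \<Sum>j \<in> A - D. f A)"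
  proof (rule sum.Sigma[symmetric])
    show "finite {A. A \<in> nsets M (Suc k) \<and> D \<subseteq> A}" using fin by simp
  qed (simp add: nsets_def)
  also have "\<dots> = (\<Sum>A | A \<in> nsets M (Suc k) \<and> D \<subseteq> A. of_nat (Suc k - card D) * f A)"
    by (rule sum.cong) (auto simp: nsets_def card_Diff_subset finite_subset)
  finally show ?thesis by (simp add: sum_distrib_left)
qed

lemma card_supersets_avoiding:
  assumes "finite M" "A \<subseteq> M" "B \<subseteq> M" "A \<inter> B = {}" "card A \<le> m"
  shows "card {X \<in> nsets M m. A \<subseteq> X \<and> X \<inter> B = {}} = (card M - card A - card B) choose (m - card A)"
proof -
  have fin: "finite A" "finite B" using assms(1-3) by (auto intro: finite_subset)
  have "bij_betw (\<lambda>X. X - A) {X \<in> nsets M m. A \<subseteq> X \<and> X \<inter> B = {}} (nsets (M - A - B) (m - card A))"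
    by (rule bij_betwI[where g = "\<lambda>Y. Y \<union> A"])
       (use assms fin in \<open>auto simp: nsets_def card_Diff_subset card_Un_disjoint Int_Diff
          intro!: card_Un_disjoint[THEN trans]\<close>)
  then have "card {X \<in> nsets M m. A \<subseteq> X \<and> X \<inter> B = {}} = card (nsets (M - A - B) (m - card A))"
    by (rule bij_betw_same_card)
  also have "\<dots> = card (M - A - B) choose (m - card A)"
  proof -
    have "finite (M - A - B)" using assms(1) by simp
    then have "nsets (M - A - B) (m - card A) = {Y. Y \<subseteq> M - A - B \<and> card Y = m - card A}"
      unfolding nsets_def by (auto intro: finite_subset)
    then show ?thesis using n_subsets[OF \<open>finite (M - A - B)\<close>] by simp
  qed
  also have "card (M - A - B) = card M - card A - card B"
  proof -
    have "card (M - A - B) = card (M - A) - card B"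
      using assms(3,4) fin by (intro card_Diff_subset) auto
    then show ?thesis using assms(2) fin by (simp add: card_Diff_subset)
  qed
  finally show ?thesis .
qed

context relation_ideal
begin

definition superset_sum :: "nat \<Rightarrow> nat set \<Rightarrow> nat set \<Rightarrow> cpoly" where
  "superset_sum k D V = (\<Sum>A | A \<in> nsets N k \<and> D \<subseteq> A \<and> A \<inter> V = {}. set_monomial A)"

text \<open>
  Summing \<open>up_relation\<close> over all \<open>C \<supseteq> D\<close> of size \<open>k - 1\<close> gives this sum with the nonzero factor
  \<open>k - card D\<close>.
\<close>

lemma superset_sum_in_J:
  assumes "even k" "card D < k"
  shows "superset_sum k D {} \<in> J"
proof -
  obtain k' where k': "k = Suc k'" using assms(2) by (cases k) auto
  have "(\<Sum>C | C \<in> nsets N k' \<and> D \<subseteq> C. \<Sum>j \<in> N - C. set_monomial (insert j C)) \<in> J"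
    using assms(1) k' by (intro J_sum up_relation) (auto simp: nsets_def)
  then have "of_nat (k - card D) * superset_sum k D {} \<in> J"
    unfolding superset_sum_def k' by (simp add: sum_over_extensions)
  then have "const (of_nat (k - card D)) * superset_sum k D {} \<in> J"
    by (simp add: const_def)
  then show ?thesis using assms(2) by (rule_tac J_const_cancel) auto
qed

text \<open>
  Induction on \<open>V\<close>: a set containing \<open>D\<close> and avoiding \<open>V\<close> either contains a further vertex \<open>v\<close> or avoids it
  as well. The sum over both kinds is \<open>0\<close> as long as \<open>card D + card V < k\<close>, so moving \<open>v\<close> from \<open>V\<close> to \<open>D\<close>
  only changes the sign.
\<close>

lemma superset_sum_eqv:
  assumes "even k" "D \<union> V \<subseteq> N" "D \<inter> V = {}" "card D + card V \<le> k"
  shows "superset_sum k D V \<simeq>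
    (if card D + card V = k then const ((-1) ^ card V) * set_monomial (D \<union> V) else 0)"
proof -
  have "finite V" using assms(2) finite_subset by blast
  then show ?thesis using assms(2-)
  proof (induction V arbitrary: D rule: finite_induct)
    case empty
    have finD: "finite D" using empty(1) finite_subset by blast
    show ?case
    proof (cases "card D = k")
      case True
      then have "{A. A \<in> nsets N k \<and> D \<subseteq> A \<and> A \<inter> {} = {}} = {D}"
        using finD empty(1) by (auto simp: nsets_def dest: card_subset_eq)
      then show ?thesis using True by (simp add: superset_sum_def)
    next
      case False
      then show ?thesis using superset_sum_in_J[OF assms(1), of D] empty by (simp add: eqv_0_iff)
    qed
  next
    case (insert v V)
    have finD: "finite D" using insert.prems finite_subset by blast
    have v: "v \<notin> D" using insert.prems by blast
    have split: "superset_sum k D V = superset_sum k (insert v D) V + superset_sum k D (insert v V)"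
    proof -
      have eq: "{A. A \<in> nsets N k \<and> D \<subseteq> A \<and> A \<inter> V = {}} =
        {A. A \<in> nsets N k \<and> insert v D \<subseteq> A \<and> A \<inter> V = {}} \<union>
        {A. A \<in> nsets N k \<and> D \<subseteq> A \<and> A \<inter> insert v V = {}}" by blast
      show ?thesis unfolding superset_sum_def eq
        by (rule sum.union_disjoint) auto
    qed
    have less: "card D + card V < k" using insert by simp
    have "superset_sum k D V \<simeq> 0"
      using insert.IH[of D] insert.prems less by auto
    moreover have "superset_sum k (insert v D) V \<simeq>
      (if card D + card (insert v V) = k then const ((-1) ^ card V) * set_monomial (D \<union> insert v V) else 0)"
      using insert.IH[of "insert v D"] insert.prems insert.hyps finD v by auto
    ultimately have "superset_sum k D V - superset_sum k (insert v D) V \<simeq> 0 -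
      (if card D + card (insert v V) = k then const ((-1) ^ card V) * set_monomial (D \<union> insert v V) else 0)"
      by (rule eqv_diff)
    then show ?case unfolding split using insert.hyps
      by (auto simp: const_uminus split: if_splits)
  qed
qed

section \<open>Averaging over halvings\<close>

definition avoids :: "nat set \<Rightarrow> nat set \<Rightarrow> complex" where
  "avoids B X = (if B \<inter> X = {} then 1 else 0)"

text \<open>
  A function on the halvings is integrated against the kernel \<open>\<Sum>A \<in> nsets X k. set_monomial A\<close>.
\<close>

definition pairing :: "nat \<Rightarrow> (nat set \<Rightarrow> complex) \<Rightarrow> cpoly" where
  "pairing k f = (\<Sum>X \<in> nsets N a. const (f X) * (\<Sum>A \<in> nsets X k. set_monomial A))"

lemma pairing_add: "pairing k (\<lambda>X. f X + g X) = pairing k f + pairing k g"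
  by (simp add: pairing_def const_add distrib_right sum.distrib)

lemma pairing_const_mult: "pairing k (\<lambda>X. c * f X) = const c * pairing k f"
  by (simp add: pairing_def const_mult sum_distrib_left mult.assoc)

lemma pairing_sum: "pairing k (\<lambda>X. \<Sum>i\<in>I. f i X) = (\<Sum>i\<in>I. pairing k (f i))"
  unfolding pairing_def const_sum sum_distrib_right by (rule sum.swap)

text \<open>
  After exchanging the two sums, a \<open>k\<close>-set \<open>A\<close> disjoint from \<open>B\<close> is counted once for each \<open>a\<close>-set \<open>X\<close> between
  \<open>A\<close> and \<open>N - B\<close>. The number of these does not depend on \<open>A\<close>.
\<close>

lemma pairing_avoids:
  assumes "B \<subseteq> N" "k \<le> a"
  shows "pairing k (avoids B) =
    const (of_nat ((2 * a - k - card B) choose (a - k))) * superset_sum k {} B"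
proof -
  have fin: "finite X" if "X \<in> nsets N a" for X using that by (simp add: nsets_def)
  have "pairing k (avoids B) =
     (\<Sum>X \<in> nsets N a. \<Sum>A \<in> nsets N k. if A \<subseteq> X \<and> B \<inter> X = {} then set_monomial A else 0)"
    unfolding pairing_def
  proof (rule sum.cong[OF refl])
    fix X assume X: "X \<in> nsets N a"
    have "nsets X k = {A \<in> nsets N k. A \<subseteq> X}" using X by (auto simp: nsets_def)
    then have "(\<Sum>A \<in> nsets X k. set_monomial A) = (\<Sum>A \<in> nsets N k. if A \<subseteq> X then set_monomial A else 0)"
      by (simp add: sum.inter_filter)
    then show "const (avoids B X) * (\<Sum>A \<in> nsets X k. set_monomial A) =
        (\<Sum>A \<in> nsets N k. if A \<subseteq> X \<and> B \<inter> X = {} then set_monomial A else 0)"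
      by (auto simp: avoids_def)
  qed
  also have "\<dots> = (\<Sum>A \<in> nsets N k. \<Sum>X \<in> nsets N a. if A \<subseteq> X \<and> B \<inter> X = {} then set_monomial A else 0)"
    by (rule sum.swap)
  also have "\<dots> = (\<Sum>A \<in> nsets N k. if A \<inter> B = {}
      then const (of_nat ((2 * a - k - card B) choose (a - k))) * set_monomial A else 0)"
  proof (rule sum.cong[OF refl])
    fix A assume A: "A \<in> nsets N k"
    have "(\<Sum>X \<in> nsets N a. if A \<subseteq> X \<and> B \<inter> X = {} then set_monomial A else 0) =
        of_nat (card {X \<in> nsets N a. A \<subseteq> X \<and> X \<inter> B = {}}) * set_monomial A"
      by (simp add: sum.inter_filter[symmetric] Int_commute)
    also have "\<dots> = (if A \<inter> B = {} then const (of_nat ((2 * a - k - card B) choose (a - k))) * set_monomial A else 0)"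
    proof (cases "A \<inter> B = {}")
      case True
      then have "card {X \<in> nsets N a. A \<subseteq> X \<and> X \<inter> B = {}} = (2 * a - k - card B) choose (a - k)"
        using card_supersets_avoiding[of N A B a] A assms by (simp add: nsets_def)
      then show ?thesis using True by (simp add: const_def)
    next
      case False
      then have "{X \<in> nsets N a. A \<subseteq> X \<and> X \<inter> B = {}} = {}" by blast
      then show ?thesis using False by (simp only: card.empty) simp
    qed
    finally show "(\<Sum>X \<in> nsets N a. if A \<subseteq> X \<and> B \<inter> X = {} then set_monomial A else 0) = \<dots>" .
  qed
  also have "\<dots> = const (of_nat ((2 * a - k - card B) choose (a - k))) * superset_sum k {} B"
    by (simp add: superset_sum_def sum.inter_filter[symmetric] sum_distrib_left)
  finally show ?thesis .
qed


lemma edge_product_disjoint: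
  assumes "U \<subseteq> nsets N 2" "disjoint U"
  shows "edge_product U \<simeq> set_monomial (\<Union>U)"
proof -
  have pm: "perfect_matching (\<Union>U) U"
    using assms by (auto simp: perfect_matching_def nsets_def)
  have sub: "\<Union>U \<subseteq> N" using assms(1) by (auto simp: nsets_def)
  have "card (\<Union>U) = sum card U"
    using assms by (intro card_Union_disjoint) (auto simp: nsets_def pairwise_def disjnt_def disjoint_def)
  also have "\<dots> = (\<Sum>S \<in> U. 2)" using assms(1) by (intro sum.cong) (auto simp: nsets_def)
  finally have "even (card (\<Union>U))" by simp
  then obtain V where V: "perfect_matching (\<Union>U) V" "set_monomial (\<Union>U) = edge_product V"
    using set_monomial_matching[OF sub] by metis
  show ?thesis unfolding V(2) by (rule matchings_eqv[OF sub pm V(1)])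
qed

lemma edge_product_meeting:
  assumes "U \<subseteq> nsets N 2" "\<not> disjoint U"
  shows "edge_product U \<in> J"
proof -
  have fin: "finite U" using assms(1) by (rule finite_subset) simp
  from assms(2) obtain S T where ST: "S \<in> U" "T \<in> U" "S \<noteq> T" "S \<inter> T \<noteq> {}"
    by (auto simp: disjoint_def)
  have "edge_product U = edge_product (U - {S} - {T}) * (var S * var T)"
    unfolding edge_product_def using fin ST
    by (subst prod.remove[of U S], simp, simp, subst prod.remove[of "U - {S}" T]) (auto simp: mult_ac)
  also have "\<dots> \<in> J"
    using ST assms(1) by (intro J_mult edge_product_closed meeting_product) auto
  finally show ?thesis .
qed

text \<open>
  No set of the same size is disjoint from \<open>A\<close>, so the sum in \<open>superset_sum_eqv\<close> is empty.
\<close>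

lemma set_monomial_large:
  assumes "A \<subseteq> N" "even (card A)" "card A > a"
  shows "set_monomial A \<in> J"
proof -
  have finA: "finite A" using assms(1) finite_subset by blast
  have "A' \<inter> A \<noteq> {}" if "A' \<in> nsets N (card A)" for A'
  proof
    assume "A' \<inter> A = {}"
    then have "card (A' \<union> A) = card A + card A"
      using that finA by (simp add: card_Un_disjoint nsets_def)
    moreover have "card (A' \<union> A) \<le> card N"
      using that assms(1) by (intro card_mono) (auto simp: nsets_def)
    ultimately show False using assms(3) by simp
  qed
  then have empty: "{A'. A' \<in> nsets N (card A) \<and> {} \<subseteq> A' \<and> A' \<inter> A = {}} = {}" by blast
  have "superset_sum (card A) {} A = 0" unfolding superset_sum_def empty by simp
  then have "0 \<simeq> set_monomial A"
    using superset_sum_eqv[of "card A" "{}" A] assms by simp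
  then show ?thesis by (metis eqv_0_iff eqv_sym)
qed

text \<open>
  The general function of \<open>X\<close> that depends only on how many ends of the edge \<open>S\<close> lie in \<open>X\<close>. Two instances are
  used: \<open>(c0, c1, c2) = (1, -1, 2)\<close> indicates that \<open>X\<close> does not separate the ends, and \<open>(0, 1, -2)\<close>
  that it does. Only \<open>c2\<close>, the coefficient of the indicator with the most vertices, enters the result of the pairing.
\<close>

definition edge_weight :: "complex \<Rightarrow> complex \<Rightarrow> complex \<Rightarrow> nat set \<Rightarrow> nat set \<Rightarrow> complex" where
  "edge_weight c0 c1 c2 S X = c0 + c1 * (\<Sum>i \<in> S. avoids {i} X) + c2 * avoids S X"

definition weight :: "complex \<Rightarrow> complex \<Rightarrow> complex \<Rightarrow> nat set set \<Rightarrow> nat set \<Rightarrow> complex" where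
  "weight c0 c1 c2 U X = (\<Prod>S \<in> U. edge_weight c0 c1 c2 S X)"

lemma pairing_expand_edge:
  assumes "finite U" "{i, j} \<notin> U" "i \<noteq> j"
  shows "pairing k (\<lambda>X. avoids B X * weight c0 c1 c2 (insert {i, j} U) X) =
    const c0 * pairing k (\<lambda>X. avoids B X * weight c0 c1 c2 U X) +
    const c1 * pairing k (\<lambda>X. avoids (insert i B) X * weight c0 c1 c2 U X) +
    const c1 * pairing k (\<lambda>X. avoids (insert j B) X * weight c0 c1 c2 U X) +
    const c2 * pairing k (\<lambda>X. avoids ({i, j} \<union> B) X * weight c0 c1 c2 U X)"
proof -
  have "avoids B X * weight c0 c1 c2 (insert {i, j} U) X =
      c0 * (avoids B X * weight c0 c1 c2 U X) + c1 * (avoids (insert i B) X * weight c0 c1 c2 U X)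
    + c1 * (avoids (insert j B) X * weight c0 c1 c2 U X)
    + c2 * (avoids ({i, j} \<union> B) X * weight c0 c1 c2 U X)" for X
  proof -
    have "weight c0 c1 c2 (insert {i, j} U) X =
        (c0 + c1 * (avoids {i} X + avoids {j} X) + c2 * avoids {i, j} X) * weight c0 c1 c2 U X"
      using assms by (simp add: weight_def edge_weight_def)
    moreover have "avoids (insert i B) X = avoids {i} X * avoids B X"
      "avoids (insert j B) X = avoids {j} X * avoids B X"
      "avoids ({i, j} \<union> B) X = avoids {i, j} X * avoids B X"
      by (auto simp: avoids_def)
    ultimately show ?thesis by (simp only: algebra_simps)
  qed
  then show ?thesis by (simp only: pairing_add pairing_const_mult)
qed

text \<open>
  Expanding the weights gives indicators of fewer than \<open>k\<close> vertices, and all of these pair to \<open>0\<close>.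
\<close>

lemma pairing_below:
  assumes "even k" "k \<le> a" "finite U" "U \<subseteq> nsets N 2" "B \<subseteq> N" "card B + 2 * card U < k"
  shows "pairing k (\<lambda>X. avoids B X * weight c0 c1 c2 U X) \<in> J"
  using assms(3-)
proof (induction U arbitrary: B rule: finite_induct)
  case empty
  have "superset_sum k {} B \<in> J"
    using superset_sum_eqv[of k "{}" B] empty assms(1) by (simp add: eqv_0_iff)
  then show ?case
    using pairing_avoids[of B k] empty assms(2) by (simp add: weight_def J_const)
next
  case (insert S U)
  then have "S \<in> nsets N 2" by simp
  then obtain i j where S: "S = {i, j}" "i \<noteq> j" "i \<in> N" "j \<in> N"
    by (rule nsets2_E)
  have finB: "finite B" using insert.prems finite_subset by blast
  have "card ({i, j} \<union> B) \<le> card B + 2"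
    using card_Un_le[of "{i, j}" B] S(2) by simp
  moreover have "card (insert i B) \<le> card B + 1" "card (insert j B) \<le> card B + 1"
    using finB by (simp_all add: card_insert_if)
  moreover have "card B + 2 * card U + 2 < k" using insert by simp
  ultimately show ?case
    unfolding S(1) pairing_expand_edge[OF insert.hyps(1) insert.hyps(2)[unfolded S(1)] S(2)]
    using insert.prems S by (intro J_add J_const insert.IH) auto
qed

text \<open>
  Expanding the weights, only the term taking \<open>avoids S\<close> from every edge \<open>S\<close> can involve \<open>k\<close> distinct
  vertices. If edges meet each other or \<open>B\<close>, then even this term has fewer, and the right-hand side
  vanishes modulo \<open>J\<close>, too. The factor \<open>set_monomial B\<close> is there for the induction, which moves edges from
  \<open>U\<close> to \<open>B\<close>.
\<close>

lemma pairing_at: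
  assumes "even k" "k \<le> a" "finite U" "U \<subseteq> nsets N 2" "B \<subseteq> N" "card B + 2 * card U = k"
  shows "pairing k (\<lambda>X. avoids B X * weight c0 c1 c2 U X) \<simeq>
    const (of_nat ((2 * a - 2 * k) choose (a - k)) * c2 ^ card U) * (edge_product U * set_monomial B)"
  using assms(3-)
proof (induction U arbitrary: B rule: finite_induct)
  case empty
  have "superset_sum k {} B \<simeq> set_monomial B"
    using superset_sum_eqv[of k "{}" B] empty assms(1) by simp
  then show ?case
    using pairing_avoids[of B k] empty assms(2) eqv_const
    by (simp add: weight_def edge_product_def mult_2 diff_diff_left)
next
  case (insert S U)
  let ?\<gamma> = "of_nat ((2 * a - 2 * k) choose (a - k)) :: complex"
  let ?p = "\<lambda>B. pairing k (\<lambda>X. avoids B X * weight c0 c1 c2 U X)"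
  from insert have "S \<in> nsets N 2" by simp
  then obtain i j where S: "S = {i, j}" "i \<noteq> j" "i \<in> N" "j \<in> N"
    by (rule nsets2_E)
  have finB: "finite B" using insert.prems finite_subset by blast
  have cards: "card (insert i B) \<le> card B + 1" "card (insert j B) \<le> card B + 1"
    using finB by (simp_all add: card_insert_if)
  have total: "card B + 2 * card U + 2 = k" using insert by simp
  have evenB: "even (card B)" using total assms(1) by presburger
  have low: "?p B \<in> J" "?p (insert i B) \<in> J" "?p (insert j B) \<in> J"
    using insert.prems S cards total by (intro pairing_below assms(1,2) insert.hyps(1); simp)+
  have top: "const c2 * ?p (S \<union> B) \<simeq> const (?\<gamma> * c2 ^ card (insert S U)) * (edge_product (insert S U) * set_monomial B)"
  proof (cases "S \<inter> B = {}")
    case True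
    have "card (S \<union> B) = card B + 2"
      using True S(1,2) finB by (simp add: card_Un_disjoint)
    then have "?p (S \<union> B) \<simeq> const (?\<gamma> * c2 ^ card U) * (edge_product U * set_monomial (S \<union> B))"
      using insert.prems S(1,3,4) total by (intro insert.IH) auto
    also have "const (?\<gamma> * c2 ^ card U) * (edge_product U * set_monomial (S \<union> B)) \<simeq>
        const (?\<gamma> * c2 ^ card U) * (edge_product U * (var S * set_monomial B))"
      using insert.prems True evenB
      by (intro eqv_const eqv_mult edge_product_closed eqv_sym[OF var_set_monomial_disjoint]) auto
    finally have "const c2 * ?p (S \<union> B) \<simeq>
        const c2 * (const (?\<gamma> * c2 ^ card U) * (edge_product U * (var S * set_monomial B)))"
      by (rule eqv_const)
    also have "\<dots> = const (?\<gamma> * c2 ^ card (insert S U)) * (edge_product (insert S U) * set_monomial B)"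
      using insert.hyps by (simp add: const_mult edge_product_def mult_ac)
    finally show ?thesis .
  next
    case False
    then have "card (S \<inter> B) > 0" using finB by (simp add: card_gt_0_iff)
    moreover have "card S = 2" "finite S" using S(1,2) by simp_all
    ultimately have "card (S \<union> B) < card B + 2"
      using card_Un_Int[OF \<open>finite S\<close> finB] by linarith
    then have "?p (S \<union> B) \<in> J"
      using insert.prems S(1,3,4) total insert.hyps(1) by (intro pairing_below assms(1,2)) auto
    then have "const c2 * ?p (S \<union> B) \<in> J" by (rule J_const)
    moreover have "const (?\<gamma> * c2 ^ card (insert S U)) * (edge_product (insert S U) * set_monomial B) \<in> J"
    proof -
      have "edge_product (insert S U) * set_monomial B = edge_product U * (var S * set_monomial B)"
        using insert.hyps by (simp add: edge_product_def mult_ac)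
      also have "\<dots> \<in> J"
        using insert.prems evenB False by (intro J_mult edge_product_closed var_set_monomial_meeting) auto
      finally show ?thesis by (rule J_const)
    qed
    ultimately show ?thesis unfolding eqv_def by (rule J_diff)
  qed
  have "const c0 * ?p B + const c1 * ?p (insert i B) + const c1 * ?p (insert j B) \<simeq> 0"
    unfolding eqv_0_iff by (intro J_add J_const low)
  from eqv_add[OF this top] show ?case
    unfolding S(1) pairing_expand_edge[OF insert.hyps(1) insert.hyps(2)[unfolded S(1)] S(2)]
    by simp
qed

lemma single_eq_edge_product:
  assumes "\<And>S. S \<in> Poly_Mapping.keys m \<Longrightarrow> Poly_Mapping.lookup m S = 1"
  shows "Poly_Mapping.single m 1 = edge_product (Poly_Mapping.keys m)"
proof -
  have "edge_product U = Poly_Mapping.single (\<Sum>S\<in>U. Poly_Mapping.single S 1) 1" if "finite U" for U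
    using that unfolding edge_product_def
    by (induction U rule: finite_induct) (auto simp: var_def mult_single)
  moreover have "(\<Sum>S\<in>Poly_Mapping.keys m. Poly_Mapping.single S 1) = m"
    by (rule poly_mapping_eqI)
       (use assms in \<open>auto simp: lookup_sum lookup_single when_def in_keys_iff\<close>)
  ultimately show ?thesis by simp
qed

lemma monomial_cases:
  assumes "Poly_Mapping.keys m \<subseteq> nsets N 2"
  obtains (squarefree) "card (Poly_Mapping.keys m) = monom_degree m"
      "Poly_Mapping.single m 1 = edge_product (Poly_Mapping.keys m)"
    | (square) "card (Poly_Mapping.keys m) < monom_degree m" "Poly_Mapping.single m 1 \<in> J"
proof (cases "\<forall>S \<in> Poly_Mapping.keys m. Poly_Mapping.lookup m S = 1")
  case True
  then show ?thesis using squarefree single_eq_edge_product by (auto simp: monom_degree_def)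
next
  case False
  then obtain S where S: "S \<in> Poly_Mapping.keys m" "Poly_Mapping.lookup m S \<noteq> 1" by blast
  then have S2: "Poly_Mapping.lookup m S \<ge> 2" by (simp add: in_keys_iff)
  have "(\<Sum>T\<in>Poly_Mapping.keys m. 1) < monom_degree m"
    unfolding monom_degree_def
  proof (rule sum_strict_mono_ex1)
    show "\<exists>T\<in>Poly_Mapping.keys m. 1 < Poly_Mapping.lookup m T" using S S2 by (intro bexI[of _ S]) auto
  qed (auto simp: in_keys_iff Suc_le_eq)
  moreover have "Poly_Mapping.single m 1 \<in> J"
  proof -
    \<comment> \<open>\<open>x\<^sub>S\<^sup>2\<close> is a product generator, and \<open>q\<close> is the cofactor\<close>
    define q where "q = m - Poly_Mapping.single S 2"
    have m: "m = q + (Poly_Mapping.single S 1 + Poly_Mapping.single S 1)"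
      by (rule poly_mapping_eqI)
         (use S2 in \<open>auto simp: q_def lookup_add lookup_minus lookup_single when_def\<close>)
    have "Poly_Mapping.keys q \<subseteq> Poly_Mapping.keys m"
      by (auto simp: q_def in_keys_iff lookup_minus)
    then have "Poly_Mapping.single q 1 \<in> R" using assms by (intro poly_ring_single) auto
    moreover have "var S * var S \<in> J"
      using S assms by (intro meeting_product) (auto simp: nsets_def)
    ultimately have "Poly_Mapping.single q 1 * (var S * var S) \<in> J" by (rule J_mult)
    then show ?thesis by (subst m) (simp add: var_mult_var mult_single)
  qed
  ultimately show ?thesis using square by simp
qed

text \<open>
  Such a monomial has a square or two meeting edges, or it is a matching with more than \<open>a\<close> vertices.
\<close>

lemma monomial_large:
  assumes "Poly_Mapping.keys m \<subseteq> nsets N 2" "2 * monom_degree m > a"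
  shows "Poly_Mapping.single m 1 \<in> J"
  using assms(1)
proof (cases rule: monomial_cases)
  case squarefree
  let ?U = "Poly_Mapping.keys m"
  show ?thesis
  proof (cases "disjoint ?U")
    case True
    have "card (\<Union>?U) = sum card ?U"
      using assms True by (intro card_Union_disjoint) (auto simp: nsets_def pairwise_def disjnt_def disjoint_def)
    also have "\<dots> = (\<Sum>S \<in> ?U. 2)" using assms(1) by (intro sum.cong) (auto simp: nsets_def)
    finally have "card (\<Union>?U) = 2 * monom_degree m" using squarefree(1) by simp
    then have "set_monomial (\<Union>?U) \<in> J"
      using assms by (intro set_monomial_large) (auto simp: nsets_def)
    then show ?thesis
      using eqv_J_iff[OF edge_product_disjoint[OF assms(1) True]] squarefree(2) by simp
  next
    case False
    then show ?thesis using edge_product_meeting assms(1) squarefree(2) by simp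
  qed
qed

text \<open>
  The pairing reproduces a monomial of degree \<open>d\<close> and kills those of smaller degree; monomials with
  a square are \<open>0\<close> modulo \<open>J\<close>, and their set of edges is too small to be seen.
\<close>

lemma pairing_monomial:
  assumes "Poly_Mapping.keys m \<subseteq> nsets N 2" "2 * d \<le> a" "monom_degree m \<le> d"
  shows "pairing (2 * d) (weight c0 c1 c2 (Poly_Mapping.keys m)) \<simeq>
    (if monom_degree m = d
     then const (of_nat ((2 * a - 4 * d) choose (a - 2 * d)) * c2 ^ d) * Poly_Mapping.single m 1 else 0)"
    (is "?p \<simeq> ?r")
proof (cases "card (Poly_Mapping.keys m) = d")
  case True
  have sq: "monom_degree m = d" "Poly_Mapping.single m 1 = edge_product (Poly_Mapping.keys m)"
    using assms(1) by (cases rule: monomial_cases; use True assms(3) in simp)+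
  show ?thesis
    using pairing_at[of "2 * d" "Poly_Mapping.keys m" "{}" c0 c1 c2] True sq assms
    by (simp add: avoids_def)
next
  case False
  have "card (Poly_Mapping.keys m) \<le> monom_degree m"
    using assms(1) by (cases rule: monomial_cases) auto
  then have "card (Poly_Mapping.keys m) < d" using False assms(3) by simp
  then have "?p \<in> J"
    using pairing_below[of "2 * d" "Poly_Mapping.keys m" "{}" c0 c1 c2] assms
    by (simp add: avoids_def)
  moreover have "?r \<in> J"
    using assms(1) by (cases rule: monomial_cases) (use False in \<open>auto simp: J_const\<close>)
  ultimately show ?thesis unfolding eqv_def by (rule J_diff)
qed

lemma hom_component_monomials:
  "hom_component d f = (\<Sum>m \<in> Poly_Mapping.keys f. const (Poly_Mapping.lookup f m) *
     (if monom_degree m = d then Poly_Mapping.single m 1 else 0))"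
  unfolding hom_component_def
  by (rule sum.mono_neutral_cong_left) (auto simp: const_def mult_single)

text \<open>
  \<open>W m\<close> plays the role of the values of the monomial \<open>m\<close>, as a function of the halving. For the locus
  of halvings these are the values themselves, for the perfect matchings they are sums of values over
  several points.
\<close>

lemma hom_component_in_J:
  assumes "f \<in> R" "degree_le f d"
    and annihilated: "\<And>X. X \<in> nsets N a \<Longrightarrow>
      (\<Sum>m \<in> Poly_Mapping.keys f. Poly_Mapping.lookup f m * W m X) = 0"
    and reproducing: "\<And>m. 2 * d \<le> a \<Longrightarrow> Poly_Mapping.keys m \<subseteq> nsets N 2 \<Longrightarrow> monom_degree m \<le> d \<Longrightarrow>
      pairing (2 * d) (W m) \<simeq> (if monom_degree m = d then const r * Poly_Mapping.single m 1 else 0)"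
    and "2 * d \<le> a \<Longrightarrow> r \<noteq> 0"
  shows "hom_component d f \<in> J"
proof (cases "2 * d \<le> a")
  case True
  have keys: "Poly_Mapping.keys m \<subseteq> nsets N 2" "monom_degree m \<le> d" if "m \<in> Poly_Mapping.keys f" for m
    using assms(1,2) that by (auto simp: poly_ring_simps degree_le_def)
  have "0 = pairing (2 * d) (\<lambda>X. \<Sum>m \<in> Poly_Mapping.keys f. Poly_Mapping.lookup f m * W m X)"
    using annihilated by (simp add: pairing_def)
  also have "\<dots> = (\<Sum>m \<in> Poly_Mapping.keys f. const (Poly_Mapping.lookup f m) * pairing (2 * d) (W m))"
    by (simp only: pairing_sum pairing_const_mult)
  also have "\<dots> \<simeq> (\<Sum>m \<in> Poly_Mapping.keys f. const (Poly_Mapping.lookup f m) *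
     (if monom_degree m = d then const r * Poly_Mapping.single m 1 else 0))"
    using keys True by (intro eqv_sum eqv_const reproducing) auto
  also have "\<dots> = const r * hom_component d f"
    unfolding hom_component_monomials sum_distrib_left by (rule sum.cong) (auto simp: mult_ac)
  finally have "const r * hom_component d f \<in> J" by (metis eqv_0_iff eqv_sym)
  then show ?thesis using J_const_cancel assms(5) True by blast
next
  case False
  have "Poly_Mapping.single m 1 \<in> J" if "m \<in> Poly_Mapping.keys f" "monom_degree m = d" for m
    using assms(1) that False by (intro monomial_large) (simp_all add: poly_ring_simps)
  then show ?thesis unfolding hom_component_monomials by (intro J_sum J_const) simp
qed

end

section \<open>Perfect matchings across a halving\<close>

lemma eval_monom_01:
  assumes "\<And>S. S \<in> Poly_Mapping.keys m \<Longrightarrow> z S = (if P S then 1 else 0)"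
  shows "eval_monom z m = (if \<forall>S \<in> Poly_Mapping.keys m. P S then 1 else 0)"
proof -
  have "eval_monom z m = (\<Prod>S \<in> Poly_Mapping.keys m. if P S then 1 else 0)"
    unfolding eval_monom_def by (rule prod.cong) (auto simp: assms in_keys_iff zero_power)
  also have "\<dots> = (if \<forall>S \<in> Poly_Mapping.keys m. P S then 1 else 0)"
    by (auto intro: prod_zero)
  finally show ?thesis .
qed

text \<open>
  A perfect matching between \<open>X\<close> and a disjoint set \<open>Y\<close> of the same size, given by the partner of each
  element of \<open>X\<close>.
\<close>

definition crossing_matchings :: "nat set \<Rightarrow> nat set \<Rightarrow> (nat \<Rightarrow> nat) set" where
  "crossing_matchings X Y = {s \<in> X \<rightarrow>\<^sub>E Y. inj_on s X}"

definition matching_edges :: "nat set \<Rightarrow> (nat \<Rightarrow> nat) \<Rightarrow> nat set set" where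
  "matching_edges X s = (\<lambda>x. {x, s x}) ` X"

lemma card_crossing_matchings:
  assumes "finite X" "finite Y" "card X = card Y"
  shows "card (crossing_matchings X Y) = fact (card X)"
proof -
  have "card (crossing_matchings X Y) = prod ((-) (card Y)) {0..<card X}"
    unfolding crossing_matchings_def using card_inj_on_subset_funcset[OF assms(1,2) subset_refl] by simp
  also have "\<dots> = fact (card X)"
    unfolding assms(3) by (simp add: fact_prod_rev)
  finally show ?thesis .
qed

lemma finite_crossing_matchings: "finite X \<Longrightarrow> finite Y \<Longrightarrow> finite (crossing_matchings X Y)"
  unfolding crossing_matchings_def by (rule finite_subset[OF _ finite_PiE[of X "\<lambda>_. Y"]]) auto

lemma matching_edge_iff:
  assumes "X \<inter> Y = {}" "s \<in> crossing_matchings X Y" "x \<in> X" "y \<in> Y"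
  shows "{x, y} \<in> matching_edges X s \<longleftrightarrow> s x = y"
proof
  assume "{x, y} \<in> matching_edges X s"
  then obtain x' where x': "x' \<in> X" "{x, y} = {x', s x'}" by (auto simp: matching_edges_def)
  then have "s x' \<in> Y" using assms(2) by (auto simp: crossing_matchings_def)
  then show "s x = y" using x' assms by (auto simp: doubleton_eq_iff)
qed (use assms(3) in \<open>auto simp: matching_edges_def\<close>)

text \<open>
  Removing the ends of an edge of \<open>U\<close> from \<open>X\<close> and \<open>Y\<close> is a bijection onto the matchings that extend the
  other edges.
\<close>

lemma card_crossing_extensions:
  assumes "finite X" "finite Y" "card X = card Y" "X \<inter> Y = {}" "finite U" "disjoint U"
    and "\<And>S. S \<in> U \<Longrightarrow> \<exists>x \<in> X. \<exists>y \<in> Y. S = {x, y}"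
  shows "card {s \<in> crossing_matchings X Y. U \<subseteq> matching_edges X s} = fact (card X - card U)"
  using assms(5,1-4,6,7)
proof (induction U arbitrary: X Y rule: finite_induct)
  case empty
  then show ?case using card_crossing_matchings by simp
next
  case (insert S U)
  obtain x y where S: "x \<in> X" "y \<in> Y" "S = {x, y}" using insert.prems(6) by blast
  let ?X = "X - {x}" and ?Y = "Y - {y}"
  have disjS: "T \<inter> {x, y} = {}" if "T \<in> U" for T
  proof -
    have "T \<noteq> S" using that insert.hyps(2) by blast
    then show ?thesis using disjointD[OF insert.prems(5), of T S] that S(3) by simp
  qed
  have U_sub: "\<exists>x \<in> ?X. \<exists>y \<in> ?Y. T = {x, y}" if T: "T \<in> U" for T
    using insert.prems(6)[of T] disjS[OF T] T by blast
  have IH: "card {s \<in> crossing_matchings ?X ?Y. U \<subseteq> matching_edges ?X s} = fact (card ?X - card U)"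
    using insert.prems S U_sub by (intro insert.IH) (auto simp: disjoint_def)
  have "bij_betw (\<lambda>s. s(x := y)) {s \<in> crossing_matchings ?X ?Y. U \<subseteq> matching_edges ?X s}
     {s \<in> crossing_matchings X Y. insert S U \<subseteq> matching_edges X s}"
  proof (rule bij_betwI[where g = "\<lambda>s. restrict s ?X"])
    show "(\<lambda>s. s(x := y)) \<in> {s \<in> crossing_matchings ?X ?Y. U \<subseteq> matching_edges ?X s} \<rightarrow>
        {s \<in> crossing_matchings X Y. insert S U \<subseteq> matching_edges X s}"
    proof
      fix s assume s: "s \<in> {s \<in> crossing_matchings ?X ?Y. U \<subseteq> matching_edges ?X s}"
      then have s': "s \<in> ?X \<rightarrow>\<^sub>E ?Y" "inj_on s ?X" by (auto simp: crossing_matchings_def)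
      have "s(x := y) \<in> X \<rightarrow>\<^sub>E Y" using s'(1) S by (auto simp: PiE_iff extensional_def)
      moreover have "inj_on (s(x := y)) X"
        using s' S by (auto simp: inj_on_def PiE_iff)
      moreover have "matching_edges ?X s \<subseteq> matching_edges X (s(x := y))"
        by (auto simp: matching_edges_def)
      moreover have "S \<in> matching_edges X (s(x := y))"
        using S by (auto simp: matching_edges_def)
      ultimately show "s(x := y) \<in> {s \<in> crossing_matchings X Y. insert S U \<subseteq> matching_edges X s}"
        using s by (auto simp: crossing_matchings_def)
    qed
    show "(\<lambda>s. restrict s ?X) \<in> {s \<in> crossing_matchings X Y. insert S U \<subseteq> matching_edges X s} \<rightarrow>
        {s \<in> crossing_matchings ?X ?Y. U \<subseteq> matching_edges ?X s}"
    proof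
      fix s assume s: "s \<in> {s \<in> crossing_matchings X Y. insert S U \<subseteq> matching_edges X s}"
      then have s': "s \<in> X \<rightarrow>\<^sub>E Y" "inj_on s X" by (auto simp: crossing_matchings_def)
      have sx: "s x = y"
        using s S matching_edge_iff[OF insert.prems(4), of s x y] by auto
      have "restrict s ?X \<in> ?X \<rightarrow>\<^sub>E ?Y"
        using s' S(1) sx by (auto simp: PiE_iff inj_on_def)
      moreover have "inj_on (restrict s ?X) ?X" using s'(2) by (auto simp: inj_on_def)
      moreover have "T \<in> matching_edges ?X (restrict s ?X)" if T: "T \<in> U" for T
      proof -
        obtain x' where "x' \<in> X" "T = {x', s x'}" using s T by (auto simp: matching_edges_def)
        moreover have "x' \<noteq> x" using disjS[OF T] calculation by blast
        ultimately show ?thesis by (auto simp: matching_edges_def)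
      qed
      ultimately show "restrict s ?X \<in> {s \<in> crossing_matchings ?X ?Y. U \<subseteq> matching_edges ?X s}"
        by (auto simp: crossing_matchings_def)
    qed
    show "restrict (s(x := y)) ?X = s"
      if "s \<in> {s \<in> crossing_matchings ?X ?Y. U \<subseteq> matching_edges ?X s}" for s
      using that by (intro ext) (auto simp: crossing_matchings_def PiE_iff extensional_def)
    show "(restrict s ?X)(x := y) = s"
      if "s \<in> {s \<in> crossing_matchings X Y. insert S U \<subseteq> matching_edges X s}" for s
    proof -
      have "s x = y" using that S matching_edge_iff[OF insert.prems(4), of s x y] by auto
      then show ?thesis
        using that by (intro ext) (auto simp: crossing_matchings_def PiE_iff extensional_def)
    qed
  qed
  then have "card {s \<in> crossing_matchings X Y. insert S U \<subseteq> matching_edges X s} = fact (card ?X - card U)"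
    unfolding IH[symmetric] by (rule bij_betw_same_card[symmetric])
  also have "card ?X - card U = card X - card (insert S U)"
    using insert.hyps insert.prems(1) S(1) by simp
  finally show ?case .
qed

lemma matching_edges_crossing:
  assumes "X \<inter> Y = {}" "s \<in> crossing_matchings X Y"
  shows "disjoint (matching_edges X s)"
    and "S \<in> matching_edges X s \<Longrightarrow> \<exists>x \<in> X. \<exists>y \<in> Y. S = {x, y}"
    and "S \<in> matching_edges X s \<Longrightarrow> card S = 2"
proof -
  have s: "s x \<in> Y" if "x \<in> X" for x using assms(2) that by (auto simp: crossing_matchings_def)
  show "disjoint (matching_edges X s)"
  proof (rule disjointI)
    fix S T assume "S \<in> matching_edges X s" "T \<in> matching_edges X s" and ne: "S \<noteq> T"
    then obtain x x' where x: "x \<in> X" "x' \<in> X" "S = {x, s x}" "T = {x', s x'}"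
      by (auto simp: matching_edges_def)
    then have "x \<noteq> x'" using ne by auto
    then have "s x \<noteq> s x'" using assms(2) x by (auto simp: crossing_matchings_def inj_on_def)
    then show "S \<inter> T = {}" using x s[OF x(1)] s[OF x(2)] assms(1) \<open>x \<noteq> x'\<close> by auto
  qed
  show "\<exists>x \<in> X. \<exists>y \<in> Y. S = {x, y}" if "S \<in> matching_edges X s"
    using that s by (auto simp: matching_edges_def)
  show "card S = 2" if S: "S \<in> matching_edges X s"
  proof -
    from S obtain x where "x \<in> X" "S = {x, s x}" by (auto simp: matching_edges_def)
    moreover from this have "s x \<noteq> x" using s[of x] assms(1) by auto
    ultimately show ?thesis by simp
  qed
qed

definition crossing_point :: "nat \<Rightarrow> nat set \<Rightarrow> (nat \<Rightarrow> nat) \<Rightarrow> nat set \<Rightarrow> complex" where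
  "crossing_point n X s = partition_point n (matching_edges X s)"

lemma crossing_point_in_matching_locus:
  assumes "X \<in> nsets {1..2 * a} a" "s \<in> crossing_matchings X ({1..2 * a} - X)"
  shows "crossing_point (2 * a) X s \<in> matching_locus a"
proof -
  let ?Y = "{1..2 * a} - X" and ?P = "matching_edges X s"
  have X: "X \<subseteq> {1..2 * a}" "finite X" "card X = a" using assms(1) by (auto simp: nsets_def)
  have s: "s ` X \<subseteq> ?Y" "inj_on s X" using assms(2) by (auto simp: crossing_matchings_def)
  have "card (s ` X) = card ?Y" using X s(2) by (simp add: card_image card_Diff_subset)
  then have "s ` X = ?Y" using s(1) by (intro card_subset_eq) auto
  then have "\<Union>?P = {1..2 * a}" using X(1) by (auto simp: matching_edges_def)
  moreover have "disjoint ?P" by (rule matching_edges_crossing(1)[OF _ assms(2)]) auto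
  ultimately have "partition_on {1..2 * a} ?P" by (auto simp: partition_on_def matching_edges_def)
  moreover have "card ?P = a"
  proof -
    have "inj_on (\<lambda>x. {x, s x}) X"
      using s(1) by (auto simp: inj_on_def doubleton_eq_iff)
    then show ?thesis unfolding matching_edges_def using X(3) by (simp add: card_image)
  qed
  moreover have "card B = 2" if "B \<in> ?P" for B
    by (rule matching_edges_crossing(3)[OF _ assms(2) that]) simp
  ultimately show ?thesis
    unfolding matching_locus_def uniform_locus_def crossing_point_def
    by (auto simp: mult.commute)
qed

context relation_ideal
begin

section \<open>Upper bounds for the graded ideals\<close>

lemma eval_monom_cut_point:
  assumes "Poly_Mapping.keys m \<subseteq> nsets N 2"
  shows "eval_monom (cut_point (2 * a) X) m = weight 1 (- 1) 2 (Poly_Mapping.keys m) X"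
proof -
  have ew: "edge_weight 1 (- 1) 2 S X = (if S \<subseteq> X \<or> S \<inter> X = {} then 1 else 0)" if "S \<in> nsets N 2" for S
  proof -
    from that obtain i j where "S = {i, j}" "i \<noteq> j" by (rule nsets2_E)
    then show ?thesis by (auto simp: edge_weight_def avoids_def)
  qed
  have "eval_monom (cut_point (2 * a) X) m =
      (if \<forall>S \<in> Poly_Mapping.keys m. S \<subseteq> X \<or> S \<inter> X = {} then 1 else 0)"
    by (rule eval_monom_01) (use assms in \<open>auto simp: cut_point_def\<close>)
  also have "\<dots> = (\<Prod>S \<in> Poly_Mapping.keys m. if S \<subseteq> X \<or> S \<inter> X = {} then 1 else 0)"
    by (auto intro: prod_zero)
  also have "\<dots> = weight 1 (- 1) 2 (Poly_Mapping.keys m) X"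
    unfolding weight_def by (rule prod.cong[OF refl]) (rule ew[OF subsetD[OF assms], symmetric])
  finally show ?thesis .
qed

lemma gr_halves_le:
  assumes "a \<ge> 1"
  shows "gr_ideal (2 * a) (halves_locus a) \<subseteq> J"
proof (rule gr_ideal_leI[OF J_ideal])
  fix f d assume f: "f \<in> vanishing_ideal (2 * a) (halves_locus a)" and d: "degree_le f d"
  from f have fR: "f \<in> R" by (simp add: vanishing_ideal_def)
  show "hom_component d f \<in> J"
  proof (rule hom_component_in_J[OF fR d, where W = "\<lambda>m. weight 1 (- 1) 2 (Poly_Mapping.keys m)"
        and r = "of_nat ((2 * a - 4 * d) choose (a - 2 * d)) * 2 ^ d"])
    fix X assume "X \<in> nsets N a"
    then have "eval_poly (cut_point (2 * a) X) f = 0"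
      using f halves_locus_eq[OF assms] by (auto simp: vanishing_ideal_def)
    then show "(\<Sum>m \<in> Poly_Mapping.keys f. Poly_Mapping.lookup f m *
        weight 1 (- 1) 2 (Poly_Mapping.keys m) X) = 0"
      using fR eval_monom_cut_point
      by (simp add: eval_poly_superset[OF _ subset_refl] poly_ring_simps)
  next
    fix m assume "2 * d \<le> a" "Poly_Mapping.keys m \<subseteq> nsets N 2" "monom_degree m \<le> d"
    then show "pairing (2 * d) (weight 1 (- 1) 2 (Poly_Mapping.keys m)) \<simeq>
      (if monom_degree m = d
       then const (of_nat ((2 * a - 4 * d) choose (a - 2 * d)) * 2 ^ d) * Poly_Mapping.single m 1 else 0)"
      by (intro pairing_monomial)
  qed simp
qed

text \<open>
  A monomial is \<open>1\<close> or \<open>0\<close> at the point of a matching, according to whether the matching contains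
  all its edges; so the sum counts the crossing matchings that extend a given set of edges.
\<close>

lemma sum_eval_monom_crossing_points:
  assumes "X \<in> nsets N a" "Poly_Mapping.keys m \<subseteq> nsets N 2"
  shows "(\<Sum>s \<in> crossing_matchings X (N - X). eval_monom (crossing_point (2 * a) X s) m) =
    (if disjoint (Poly_Mapping.keys m) then fact (a - card (Poly_Mapping.keys m)) else 0) *
    weight 0 1 (- 2) (Poly_Mapping.keys m) X"
proof -
  let ?U = "Poly_Mapping.keys m" and ?Y = "N - X"
  have X: "X \<subseteq> N" "finite X" "card X = a" using assms(1) by (auto simp: nsets_def)
  have "(\<Sum>s \<in> crossing_matchings X ?Y. eval_monom (crossing_point (2 * a) X s) m) =
      (\<Sum>s \<in> crossing_matchings X ?Y. if ?U \<subseteq> matching_edges X s then 1 else 0)"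
  proof (rule sum.cong[OF refl])
    fix s assume s: "s \<in> crossing_matchings X ?Y"
    have "S \<subseteq> B \<longleftrightarrow> S = B" if "S \<in> ?U" "B \<in> matching_edges X s" for S B
    proof -
      have "card B = 2" by (rule matching_edges_crossing(3)[OF _ s that(2)]) simp
      moreover have "card S = 2" using that assms(2) by (auto simp: nsets_def)
      ultimately show ?thesis by (metis card_subset_eq card.infinite subset_refl zero_neq_numeral)
    qed
    then have "crossing_point (2 * a) X s S = (if S \<in> matching_edges X s then 1 else 0)" if "S \<in> ?U" for S
      using that assms(2) by (auto simp: crossing_point_def partition_point_def)
    from eval_monom_01[OF this] show "eval_monom (crossing_point (2 * a) X s) m =
        (if ?U \<subseteq> matching_edges X s then 1 else 0)" by (auto simp: subset_iff)
  qed
  also have "\<dots> = of_nat (card {s \<in> crossing_matchings X ?Y. ?U \<subseteq> matching_edges X s})"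
    using finite_crossing_matchings[OF X(2), of ?Y] by (simp add: sum.inter_filter[symmetric])
  also have "\<dots> = (if disjoint ?U then fact (a - card ?U) else 0) * weight 0 1 (- 2) ?U X"
  proof (cases "disjoint ?U \<and> (\<forall>S \<in> ?U. \<exists>x \<in> X. \<exists>y \<in> ?Y. S = {x, y})")
    case True
    have "edge_weight 0 1 (- 2) S X = 1" if "S \<in> ?U" for S
    proof -
      from True that obtain i j where "S = {i, j}" "i \<in> X" "j \<in> ?Y" by blast
      moreover from this have "i \<noteq> j" by blast
      ultimately show ?thesis by (auto simp: edge_weight_def avoids_def)
    qed
    then have "weight 0 1 (- 2) ?U X = 1" by (simp add: weight_def)
    moreover have "card {s \<in> crossing_matchings X ?Y. ?U \<subseteq> matching_edges X s} = fact (card X - card ?U)"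
      using True X by (intro card_crossing_extensions) (auto simp: card_Diff_subset)
    ultimately show ?thesis using True X(3) by simp
  next
    case False
    have none: "{s \<in> crossing_matchings X ?Y. ?U \<subseteq> matching_edges X s} = {}"
    proof (rule ccontr)
      assume "\<not> ?thesis"
      then obtain s where s: "s \<in> crossing_matchings X ?Y" "?U \<subseteq> matching_edges X s" by blast
      have XY: "X \<inter> ?Y = {}" by blast
      have "disjoint ?U"
        by (rule disjointI, rule disjointD[OF matching_edges_crossing(1)[OF XY s(1)]]) (use s(2) in auto)
      moreover have "\<exists>x \<in> X. \<exists>y \<in> ?Y. S = {x, y}" if "S \<in> ?U" for S
        by (rule matching_edges_crossing(2)[OF XY s(1) subsetD[OF s(2) that]])
      ultimately show False using False by simp
    qed
    have "weight 0 1 (- 2) ?U X = 0" if "disjoint ?U"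
    proof -
      from that False obtain S where S: "S \<in> ?U" "\<not> (\<exists>x \<in> X. \<exists>y \<in> ?Y. S = {x, y})" by blast
      from S(1) assms(2) have "S \<in> nsets N 2" by blast
      then obtain i j where ij: "S = {i, j}" "i \<in> N" "j \<in> N" "i \<noteq> j" by (rule nsets2_E)
      have "i \<in> X \<longleftrightarrow> j \<in> X" using S(2) ij by blast
      then have "edge_weight 0 1 (- 2) S X = 0" using ij by (auto simp: edge_weight_def avoids_def)
      then show ?thesis unfolding weight_def using S(1) by (intro prod_zero) auto
    qed
    then show ?thesis unfolding none by simp
  qed
  finally show ?thesis .
qed

text \<open>
  Monomials with meeting edges are \<open>0\<close> at every matching, which is consistent with the reproducing property
  only because such monomials are in \<open>J\<close>.
\<close>

lemma gr_matching_le: "gr_ideal (2 * a) (matching_locus a) \<subseteq> J"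
proof (rule gr_ideal_leI[OF J_ideal])
  fix f d assume f: "f \<in> vanishing_ideal (2 * a) (matching_locus a)" and d: "degree_le f d"
  from f have fR: "f \<in> R" by (simp add: vanishing_ideal_def)
  let ?c = "\<lambda>m. if disjoint (Poly_Mapping.keys m) then fact (a - card (Poly_Mapping.keys m)) else 0 :: complex"
  let ?\<gamma> = "of_nat ((2 * a - 4 * d) choose (a - 2 * d)) * (- 2) ^ d :: complex"
  show "hom_component d f \<in> J"
  proof (rule hom_component_in_J[OF fR d, where W = "\<lambda>m X. ?c m * weight 0 1 (- 2) (Poly_Mapping.keys m) X"
        and r = "fact (a - d) * ?\<gamma>"])
    fix X assume X: "X \<in> nsets N a"
    have "0 = (\<Sum>s \<in> crossing_matchings X (N - X). eval_poly (crossing_point (2 * a) X s) f)"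
      using f crossing_point_in_matching_locus[OF X] by (simp add: vanishing_ideal_def)
    also have "\<dots> = (\<Sum>m \<in> Poly_Mapping.keys f. Poly_Mapping.lookup f m *
        (\<Sum>s \<in> crossing_matchings X (N - X). eval_monom (crossing_point (2 * a) X s) m))"
      unfolding eval_poly_superset[OF finite_keys subset_refl] sum_distrib_left by (rule sum.swap)
    also have "\<dots> = (\<Sum>m \<in> Poly_Mapping.keys f. Poly_Mapping.lookup f m *
        (?c m * weight 0 1 (- 2) (Poly_Mapping.keys m) X))"
      using fR sum_eval_monom_crossing_points[OF X] by (intro sum.cong) (simp_all add: poly_ring_simps)
    finally show "(\<Sum>m \<in> Poly_Mapping.keys f. Poly_Mapping.lookup f m *
        (?c m * weight 0 1 (- 2) (Poly_Mapping.keys m) X)) = 0" by simp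
  next
    fix m assume m: "2 * d \<le> a" "Poly_Mapping.keys m \<subseteq> nsets N 2" "monom_degree m \<le> d"
    let ?U = "Poly_Mapping.keys m"
    have "pairing (2 * d) (\<lambda>X. ?c m * weight 0 1 (- 2) ?U X) \<simeq>
        const (?c m) * (if monom_degree m = d then const ?\<gamma> * Poly_Mapping.single m 1 else 0)"
      unfolding pairing_const_mult by (intro eqv_const pairing_monomial m)
    also have "\<dots> \<simeq> (if monom_degree m = d then const (fact (a - d) * ?\<gamma>) * Poly_Mapping.single m 1 else 0)"
    proof (cases "Poly_Mapping.single m 1 \<in> J")
      case True
      then show ?thesis unfolding eqv_def by (intro J_diff) (simp_all add: J_const)
    next
      case False
      from m(2) have "card ?U = monom_degree m" "disjoint ?U"
        by (cases rule: monomial_cases; use False edge_product_meeting[OF m(2)] in auto)+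
      then show ?thesis by (simp add: const_mult mult.assoc)
    qed
    finally show "pairing (2 * d) (\<lambda>X. ?c m * weight 0 1 (- 2) ?U X) \<simeq>
        (if monom_degree m = d then const (fact (a - d) * ?\<gamma>) * Poly_Mapping.single m 1 else 0)" .
  qed simp
qed

end

theorem proposition3p6:
  fixes a :: nat
  assumes "a \<ge> 1"
  shows "gr_ideal (2 * a) (halves_locus a) =
           Idl\<^bsub>poly_ring (2 * a)\<^esub>
             (product_gens (2 * a) \<union> sum_gens (2 * a) \<union> difference_gens (2 * a))
       \<and> gr_ideal (2 * a) (halves_locus a) =
           gr_ideal (2 * a) (matching_locus a)
             <+>\<^bsub>poly_ring (2 * a)\<^esub> Idl\<^bsub>poly_ring (2 * a)\<^esub> (difference_gens (2 * a))"
proof -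
  let ?n = "2 * a"
  interpret P: cring "poly_ring ?n" by (rule cring_poly_ring)
  let ?gens = "product_gens ?n \<union> sum_gens ?n \<union> difference_gens ?n"
  let ?J = "Idl\<^bsub>poly_ring ?n\<^esub> ?gens" and ?D = "Idl\<^bsub>poly_ring ?n\<^esub> (difference_gens ?n)"
  have carrier: "?gens \<subseteq> carrier (poly_ring ?n)" "difference_gens ?n \<subseteq> carrier (poly_ring ?n)"
    using product_gens_carrier sum_gens_carrier difference_gens_carrier by auto
  note J_ideal = P.genideal_ideal[OF carrier(1)] and D_ideal = P.genideal_ideal[OF carrier(2)]
  interpret relation_ideal a ?J
    using P.genideal_self[OF carrier(1)] by (intro relation_ideal.intro J_ideal) auto
  have gr_halves: "gr_ideal ?n (halves_locus a) = ?J"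
    using gr_halves_le[OF assms]
      P.genideal_minimal[OF gr_ideal_ideal gens_in_gr_halves[OF assms]] by blast
  have "?J \<subseteq> gr_ideal ?n (matching_locus a) <+>\<^bsub>poly_ring ?n\<^esub> ?D"
  proof (rule P.genideal_minimal[OF P.add_ideals[OF gr_ideal_ideal D_ideal]])
    have 0: "0 \<in> gr_ideal ?n (matching_locus a)" "0 \<in> ?D"
      using additive_subgroup.zero_closed[OF ideal.axioms(1)[OF gr_ideal_ideal]]
        additive_subgroup.zero_closed[OF ideal.axioms(1)[OF D_ideal]]
      by (auto simp: poly_ring_simps)
    have "f \<in> gr_ideal ?n (matching_locus a) <+>\<^bsub>poly_ring ?n\<^esub> ?D"
      if "f \<in> gr_ideal ?n (matching_locus a) \<or> f \<in> ?D" for f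
      using that 0 unfolding set_add_def' poly_ring_simps
      by (metis (mono_tags, lifting) UN_I add.right_neutral add_0 singletonI)
    then show "?gens \<subseteq> gr_ideal ?n (matching_locus a) <+>\<^bsub>poly_ring ?n\<^esub> ?D"
      using gens_in_gr_matching[of a] P.genideal_self[OF carrier(2)] by blast
  qed
  moreover have "gr_ideal ?n (matching_locus a) <+>\<^bsub>poly_ring ?n\<^esub> ?D \<subseteq> ?J"
  proof -
    have "?D \<subseteq> ?J"
      using differences by (intro P.genideal_minimal J_ideal)
    then show ?thesis using gr_matching_le J_add
      by (auto simp: set_add_def' poly_ring_simps)
  qed
  ultimately show ?thesis using gr_halves by blast
qed

end
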